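(* Let $d$ be a positive integer. Then $\tilde{S}_d=M_d(I_d)$ is the set of smooth functions $f:\mathbb{R}\setminus\{0\}\to\mathbb{C}$ such that $f$ and all its derivatives are rapidly decreasing at $\pm\infty$ and such that $|y|^{(d-1)/2}f(y)$ is smooth on the right and on the left at $y=0$ and has $d-1$ continuous derivatives at $y=0$ (when $d=1$ the last condition means that $f$ is continuous at $0$).
   Context: $I_d$ is the space of smooth functions $\phi:\mathbb{R}\to\mathbb{C}$ such that $x\mapsto x^{-d-1}\phi(-1/x)$ ($x\neq0$) extends to a smooth function on $\mathbb{R}$. For $\phi\in I_d$, $M_d(\phi)$ is the function on $\mathbb{R}\setminus\{0\}$ given by $M_d(\phi)(y)=|y|^{(-d+1)/2}(2\pi)^{-1/2}\int_{-\infty}^{\infty}\phi(x)e^{-ixy}dx$, and $\tilde{S}_d=M_d(I_d)$ is its image. For a function $h$ on $\mathbb{R}\setminus\{0\}$: "smooth on the right and on the left at $0$" means $h|_{(0,\infty)}$ extends to a smooth function on $[0,\infty)$ and $h|_{(-\infty,0)}$ extends to a smooth function on $(-\infty,0]$; "has $d-1$ continuous derivatives at $0$" means that $h$ extends to a function on $\mathbb{R}$ that is $C^{d-1}$ in a neighbourhood of $0$ ($C^0$, i.e. continuous, if $d=1$). Rapidly decreasing at $\pm\infty$ means decaying faster than $|y|^{-N}$ for every $N$ as $|y|\to\infty$. *)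

theory Defs
  imports "HOL-Analysis.Analysis" "HOL-Library.FuncSet"
begin

(* Derivatives are taken within S.  This is only used for S open or S a closed half-line,
   where limits within S are nontrivial at every point of S; at the endpoint of a half-line
   the derivative is the one-sided one. *)
primrec nth_deriv_on :: "nat \<Rightarrow> real set \<Rightarrow> (real \<Rightarrow> complex) \<Rightarrow> real \<Rightarrow> complex" where
  "nth_deriv_on 0 S f = f"
| "nth_deriv_on (Suc n) S f = (\<lambda>x. vector_derivative (nth_deriv_on n S f) (at x within S))"

definition C_on :: "nat \<Rightarrow> real set \<Rightarrow> (real \<Rightarrow> complex) \<Rightarrow> bool" where
  "C_on k S f \<longleftrightarrow>
     (\<forall>i<k. \<forall>x\<in>S. nth_deriv_on i S f differentiable (at x within S)) \<and>
     continuous_on S (nth_deriv_on k S f)"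

definition smooth_fun_on :: "real set \<Rightarrow> (real \<Rightarrow> complex) \<Rightarrow> bool" where
  "smooth_fun_on S f \<longleftrightarrow> (\<forall>k. C_on k S f)"

definition I_space :: "nat \<Rightarrow> (real \<Rightarrow> complex) set" where
  "I_space d = {\<phi>. smooth_fun_on UNIV \<phi> \<and>
     (\<exists>\<psi>. smooth_fun_on UNIV \<psi> \<and>
        (\<forall>x. x \<noteq> 0 \<longrightarrow> \<psi> x = of_real (x powi (- int d - 1)) * \<phi> (- 1 / x)))}"

(* Functions on the punctured line are represented as extensional functions
   (undefined at 0), so that equality of functions is equality on the punctured line. *)
definition M_op :: "nat \<Rightarrow> (real \<Rightarrow> complex) \<Rightarrow> real \<Rightarrow> complex" where
  "M_op d \<phi> = (\<lambda>y\<in>UNIV - {0}.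
     of_real (\<bar>y\<bar> powr ((- real d + 1) / 2) * (2 * pi) powr (- 1 / 2)) *
     (LINT x|lborel. \<phi> x * exp (- \<i> * of_real x * of_real y)))"

definition S_tilde :: "nat \<Rightarrow> (real \<Rightarrow> complex) set" where
  "S_tilde d = M_op d ` I_space d"

definition rapidly_decreasing :: "(real \<Rightarrow> complex) \<Rightarrow> bool" where
  "rapidly_decreasing g \<longleftrightarrow>
     (\<forall>N::nat. ((\<lambda>y. \<bar>y\<bar> ^ N * norm (g y)) \<longlongrightarrow> 0) at_top \<and>
               ((\<lambda>y. \<bar>y\<bar> ^ N * norm (g y)) \<longlongrightarrow> 0) at_bot)"

(* The next three predicates do not depend on the value of h at 0. *)
definition smooth_right_at_0 :: "(real \<Rightarrow> complex) \<Rightarrow> bool" where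
  "smooth_right_at_0 h \<longleftrightarrow> (\<exists>g. smooth_fun_on {0..} g \<and> (\<forall>y>0. g y = h y))"

definition smooth_left_at_0 :: "(real \<Rightarrow> complex) \<Rightarrow> bool" where
  "smooth_left_at_0 h \<longleftrightarrow> (\<exists>g. smooth_fun_on {..0} g \<and> (\<forall>y<0. g y = h y))"

definition has_cont_derivs_at_0 :: "nat \<Rightarrow> (real \<Rightarrow> complex) \<Rightarrow> bool" where
  "has_cont_derivs_at_0 k h \<longleftrightarrow>
     (\<exists>g U. (\<forall>y. y \<noteq> 0 \<longrightarrow> g y = h y) \<and> open U \<and> 0 \<in> U \<and> C_on k U g)"

end

theory Submission
  imports Defs "HOL-Probability.Probability"
begin

text \<open>For \<open>\<phi>\<close> in \<open>I_space d\<close>, the derivative of \<open>\<phi>\<close> lies in \<open>I_space (d + 1)\<close> and its product with \<open>x\<close>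
  in \<open>I_space (d - 1)\<close>. Dividing the transform of the derivative by \<open>y\<close> gives smoothness and
  rapid decay away from 0. For one-sided smoothness, subtract multiples of \<open>(1 - \<i> x) ^ (- k - 1)\<close>,
  whose transforms are multiples of \<open>y ^ k * exp (- y)\<close> on a half-line, until the remainder decays
  so fast that its transform has any prescribed number of derivatives.

  Conversely, integrating \<open>h = \<bar>y\<bar> powr ((d - 1) / 2) * f\<close> by parts on both half-lines expands its
  transform at infinity in powers of \<open>1 / x\<close> whose coefficients are the jumps at 0 of the derivatives
  of \<open>h\<close>. The first \<open>d\<close> jumps vanish, hence the transform lies in \<open>I_space d\<close>, and Fourier inversion
  recovers \<open>h\<close>.\<close>

section \<open>Functions of class \<open>C_on\<close>\<close>

text \<open>The obstacle in the direct part is that the index must stay positive. An element of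
  \<open>I_space 1\<close> is only known to decay like 1 / x^2, so x times it need not be integrable
  and its transform cannot be differentiated under the integral. Passing to the derivative first
  restores one order of decay, at the price of a division by y, and so gives no information at 0.
  The functions (1 - \<i> x)^(- k - 1) are the characteristic functions of Gamma distributions. Such
  a function has a nonzero leading coefficient at infinity, and its transform is smooth up to 0 from
  both sides. It can therefore cancel the leading term at infinity without harming one-sided
  smoothness. In the converse, behaviour at infinity means behaviour at t = 0 of the transform
  evaluated at - 1 / t. A derivative in t costs t^(- 2), so m derivatives are only visible once the
  remainder carries 2 m + 1 powers of t. Hence the expansion is continued to an order depending on
  m, far beyond the d terms that vanish.\<close>

abbreviation punctured_line :: "real set" where
  "punctured_line \<equiv> UNIV - {0}"

text \<open>This is what makes derivatives within \<open>S\<close> unique, so that any derivative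
  that has been exhibited may replace the one chosen by \<open>vector_derivative\<close>.\<close>

definition no_isolated :: "real set \<Rightarrow> bool" where
  "no_isolated S \<longleftrightarrow> (\<forall>x\<in>S. at x within S \<noteq> bot)"

lemma no_isolated_open: "open S \<Longrightarrow> no_isolated S"
  by (metis no_isolated_def at_within_open at_neq_bot)

lemma no_isolated_UNIV: "no_isolated UNIV"
  and no_isolated_punctured_line: "no_isolated punctured_line"
  by (simp_all add: no_isolated_open open_delete)

lemma no_isolated_half_line: "no_isolated {0..}" "no_isolated {..0}"
proof -
  have "at x within {0..} \<noteq> bot" if "0 \<le> x" for x :: real
  proof -
    have "at_right x \<le> at x within {0..}"
      using that by (intro at_le) auto
    then show ?thesis by (metis bot.extremum_uniqueI trivial_limit_at_right_real)
  qed
  then show "no_isolated {0..}" by (simp add: no_isolated_def)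
  have "at x within {..0} \<noteq> bot" if "x \<le> 0" for x :: real
  proof -
    have "at_left x \<le> at x within {..0}"
      using that by (intro at_le) auto
    then show ?thesis by (metis bot.extremum_uniqueI trivial_limit_at_left_real)
  qed
  then show "no_isolated {..0}" by (simp add: no_isolated_def)
qed

lemma nth_deriv_on_cong:
  assumes "\<And>x. x \<in> S \<Longrightarrow> f x = g x" "x \<in> S"
  shows "nth_deriv_on n S f x = nth_deriv_on n S g x"
  using assms(2)
proof (induction n arbitrary: x)
  case 0
  then show ?case using assms(1) by simp
next
  case (Suc n)
  then show ?case
    by (auto intro!: vector_derivative_cong_eq always_eventually)
qed

text \<open>The definition peels off the outermost derivative; inductions on the order of
  differentiability need the innermost one.\<close>

lemma nth_deriv_on_Suc_shift:
  "nth_deriv_on (Suc n) S f = nth_deriv_on n S (nth_deriv_on 1 S f)"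
  by (induction n) simp_all

lemma nth_deriv_on_Suc_eq:
  assumes "no_isolated S" "\<And>x. x \<in> S \<Longrightarrow> (f has_vector_derivative f' x) (at x within S)" "x \<in> S"
  shows "nth_deriv_on (Suc n) S f x = nth_deriv_on n S f' x"
  unfolding nth_deriv_on_Suc_shift
  by (rule nth_deriv_on_cong) (use assms in \<open>auto simp: no_isolated_def intro: vector_derivative_within\<close>)

text \<open>At interior points the derivative does not see the ambient set. This links derivatives
  taken within a closed half-line or a neighbourhood of 0 to those taken on the punctured
  line.\<close>

lemma nth_deriv_on_local:
  assumes "open V" "V \<subseteq> S" "V \<subseteq> T" "\<And>x. x \<in> V \<Longrightarrow> f x = g x" "x \<in> V"
  shows "nth_deriv_on n S f x = nth_deriv_on n T g x"
  using assms(5)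
proof (induction n arbitrary: x)
  case 0
  then show ?case using assms by simp
next
  case (Suc n)
  have "x \<in> interior S" "x \<in> interior T"
    using Suc.prems assms by (meson interior_maximal subsetD)+
  then have "at x within S = at x" "at x within T = at x"
    by (metis at_within_interior)+
  moreover have "\<forall>\<^sub>F x in nhds x. nth_deriv_on n S f x = nth_deriv_on n T g x"
    using Suc assms(1) by (auto simp: eventually_nhds)
  ultimately show ?case
    by (simp add: vector_derivative_cong_eq)
qed

lemma C_on_cong:
  assumes "\<And>x. x \<in> S \<Longrightarrow> f x = g x"
  shows "C_on k S f \<longleftrightarrow> C_on k S g"
proof -
  have *: "nth_deriv_on n S f x = nth_deriv_on n S g x" if "x \<in> S" for n x
    using assms that by (rule nth_deriv_on_cong)
  have "nth_deriv_on n S f differentiable at x within S \<longleftrightarrow> nth_deriv_on n S g differentiable at x within S"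
    if "x \<in> S" for n x
    unfolding differentiable_def using * that by (metis has_derivative_transform)
  moreover have "continuous_on S (nth_deriv_on k S f) \<longleftrightarrow> continuous_on S (nth_deriv_on k S g)"
    using * by (simp cong: continuous_on_cong)
  ultimately show ?thesis by (simp add: C_on_def)
qed

lemma C_on_0: "C_on 0 S f \<longleftrightarrow> continuous_on S f"
  by (simp add: C_on_def)

text \<open>With \<open>C_on_SucD\<close> this turns the indexed definition into a recursion on
  \<open>k\<close>. The closure properties below become inductions that exhibit one derivative and
  never compute \<open>nth_deriv_on\<close>.\<close>

lemma C_on_SucI:
  assumes "no_isolated S"
    and "\<And>x. x \<in> S \<Longrightarrow> (f has_vector_derivative f' x) (at x within S)"
    and "C_on k S f'"
  shows "C_on (Suc k) S f"
proof -
  have eq: "nth_deriv_on (Suc n) S f x = nth_deriv_on n S f' x" if "x \<in> S" for x n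
    using assms(1,2) that by (rule nth_deriv_on_Suc_eq)
  have "nth_deriv_on i S f differentiable (at x within S)" if "i < Suc k" "x \<in> S" for i x
  proof (cases i)
    case 0
    then show ?thesis using assms(2) that by (auto intro: differentiableI_vector)
  next
    case (Suc j)
    then have "nth_deriv_on j S f' differentiable (at x within S)"
      using assms(3) that by (simp add: C_on_def)
    then show ?thesis
      unfolding Suc differentiable_def using eq that(2) by (blast intro: has_derivative_transform)
  qed
  moreover have "continuous_on S (nth_deriv_on (Suc k) S f)"
    using assms(3) eq by (simp add: C_on_def cong: continuous_on_cong del: nth_deriv_on.simps)
  ultimately show ?thesis by (simp add: C_on_def)
qed

lemma C_on_SucD:
  assumes "C_on (Suc k) S f"
  shows "\<And>x. x \<in> S \<Longrightarrow> (f has_vector_derivative nth_deriv_on 1 S f x) (at x within S)"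
    and "C_on k S (nth_deriv_on 1 S f)"
proof -
  show "(f has_vector_derivative nth_deriv_on 1 S f x) (at x within S)" if "x \<in> S" for x
    using assms that by (auto simp: C_on_def vector_derivative_works[symmetric])
  show "C_on k S (nth_deriv_on 1 S f)"
    using assms unfolding C_on_def nth_deriv_on_Suc_shift[symmetric] by auto
qed

lemma C_on_lessI:
  assumes "no_isolated S" "C_on k S f" "j \<le> k"
  shows "C_on j S f"
proof (cases "j = k")
  case False
  then have "\<forall>x\<in>S. nth_deriv_on j S f differentiable (at x within S)"
    using assms by (simp add: C_on_def)
  then have "continuous_on S (nth_deriv_on j S f)"
    by (simp add: differentiable_imp_continuous_on differentiable_on_def)
  then show ?thesis using assms by (auto simp: C_on_def)
qed (use assms in simp)

lemma C_on_subset: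
  assumes "no_isolated S" "no_isolated T" "T \<subseteq> S" "C_on k S f"
  shows "C_on k T f"
  using assms(4)
proof (induction k arbitrary: f)
  case 0
  then show ?case using assms(3) by (auto simp: C_on_0 intro: continuous_on_subset)
next
  case (Suc k)
  then obtain f' where "\<And>x. x \<in> S \<Longrightarrow> (f has_vector_derivative f' x) (at x within S)" "C_on k S f'"
    using C_on_SucD by blast
  then show ?case
    using Suc.IH assms(2,3)
    by (intro C_on_SucI[where f' = f']) (auto intro: has_vector_derivative_within_subset)
qed

lemma C_on_const:
  assumes "no_isolated S"
  shows "C_on k S (\<lambda>x. c)"
proof (induction k arbitrary: c)
  case (Suc k)
  show ?case
    by (rule C_on_SucI[OF assms, where f' = "\<lambda>_. 0"]) (simp_all add: Suc)
qed (simp add: C_on_0)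

lemma C_on_of_real:
  assumes "no_isolated S"
  shows "C_on k S of_real"
proof (cases k)
  case (Suc n)
  have "(complex_of_real has_vector_derivative 1) (at x within S)" for x
    using has_vector_derivative_of_real[OF DERIV_ident] by fastforce
  then show ?thesis
    unfolding Suc by (intro C_on_SucI[OF assms _ C_on_const[OF assms]])
qed (simp add: C_on_0 continuous_intros)

lemma C_on_add:
  assumes "no_isolated S" "C_on k S f" "C_on k S g"
  shows "C_on k S (\<lambda>x. f x + g x)"
  using assms(2,3)
proof (induction k arbitrary: f g)
  case (Suc k)
  obtain f' where f': "\<And>x. x \<in> S \<Longrightarrow> (f has_vector_derivative f' x) (at x within S)" "C_on k S f'"
    using C_on_SucD[OF Suc.prems(1)] by blast
  obtain g' where g': "\<And>x. x \<in> S \<Longrightarrow> (g has_vector_derivative g' x) (at x within S)" "C_on k S g'"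
    using C_on_SucD[OF Suc.prems(2)] by blast
  show ?case
    using f' g' Suc.IH
    by (intro C_on_SucI[OF assms(1), where f' = "\<lambda>x. f' x + g' x"] has_vector_derivative_add) auto
qed (simp add: C_on_0 continuous_intros)

lemma C_on_mult:
  assumes "no_isolated S" "C_on k S f" "C_on k S g"
  shows "C_on k S (\<lambda>x. f x * g x)"
  using assms(2,3)
proof (induction k arbitrary: f g)
  case (Suc k)
  obtain f' where f': "\<And>x. x \<in> S \<Longrightarrow> (f has_vector_derivative f' x) (at x within S)" "C_on k S f'"
    using C_on_SucD[OF Suc.prems(1)] by blast
  obtain g' where g': "\<And>x. x \<in> S \<Longrightarrow> (g has_vector_derivative g' x) (at x within S)" "C_on k S g'"
    using C_on_SucD[OF Suc.prems(2)] by blast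
  have "C_on k S f" "C_on k S g"
    using Suc.prems assms(1) by (auto intro: C_on_lessI)
  then have "C_on k S (\<lambda>x. f x * g' x + f' x * g x)"
    using f' g' by (intro C_on_add[OF assms(1)] Suc.IH)
  then show ?case
    using f' g' by (intro C_on_SucI[OF assms(1)]) (auto intro: has_vector_derivative_mult)
qed (simp add: C_on_0 continuous_intros)

lemma C_on_cmult:
  assumes "no_isolated S" "C_on k S f"
  shows "C_on k S (\<lambda>x. c * f x)"
  using C_on_mult[OF assms(1) C_on_const[OF assms(1)] assms(2)] .

lemma C_on_power:
  assumes "no_isolated S"
  shows "C_on k S (\<lambda>x. of_real x ^ n)"
proof (induction n)
  case (Suc n)
  then show ?case using C_on_mult[OF assms C_on_of_real[OF assms] Suc] by simp
qed (simp add: C_on_const[OF assms])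

lemma smooth_fun_on_deriv:
  assumes "smooth_fun_on S f"
  shows "\<And>x. x \<in> S \<Longrightarrow> (f has_vector_derivative nth_deriv_on 1 S f x) (at x within S)"
    and "smooth_fun_on S (nth_deriv_on 1 S f)"
  using assms C_on_SucD unfolding smooth_fun_on_def by blast+

text \<open>The derivative is a constant times the same expression with exponent
  \<open>Suc n\<close>, so the induction on \<open>k\<close> runs with \<open>n\<close>
  arbitrary.\<close>

lemma C_on_inverse_affine_power:
  fixes a b :: complex
  assumes "no_isolated S" "\<And>x. a + b * of_real x \<noteq> 0"
  shows "C_on k S (\<lambda>x. inverse ((a + b * of_real x) ^ n))"
proof (induction k arbitrary: n)
  case 0
  show ?case using assms(2) by (auto simp: C_on_0 intro!: continuous_intros)
next
  case (Suc k)
  have "((\<lambda>x. inverse ((a + b * of_real x) ^ n)) has_vector_derivative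
     (- of_nat n * b) * inverse ((a + b * of_real x) ^ Suc n)) (at x within S)" for x
  proof (rule has_vector_derivative_real_field)
    define u where "u = a + b * of_real x"
    have "u \<noteq> 0" using assms(2) by (simp add: u_def)
    have "((\<lambda>x. a + b * x) has_field_derivative b) (at (of_real x))"
      by (auto intro!: derivative_eq_intros)
    then have "((\<lambda>x. inverse ((a + b * x) ^ n)) has_field_derivative
        - (inverse (u ^ n) * (of_nat n * (b * u ^ (n - Suc 0))) * inverse (u ^ n))) (at (of_real x))"
      using DERIV_inverse'[OF DERIV_power] \<open>u \<noteq> 0\<close> by (fastforce simp: u_def)
    also have "- (inverse (u ^ n) * (of_nat n * (b * u ^ (n - Suc 0))) * inverse (u ^ n))
        = (- of_nat n * b) * inverse (u ^ Suc n)"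
      using \<open>u \<noteq> 0\<close> by (cases n) (simp_all add: field_simps del: of_nat_Suc)
    finally show "((\<lambda>x. inverse ((a + b * x) ^ n)) has_field_derivative
       (- of_nat n * b) * inverse ((a + b * of_real x) ^ Suc n)) (at (of_real x))"
      by (simp add: u_def)
  qed
  then show ?case
    by (rule C_on_SucI[OF assms(1)]) (intro C_on_cmult assms(1) Suc.IH)
qed

text \<open>Hadamard's lemma: the quotient is the mean of f' over the segment from 0 to x, that is,
  the integral of f'(t x) over t in [0, 1].\<close>

lemma smooth_divide_by_id:
  assumes f: "smooth_fun_on UNIV f" and "f 0 = 0"
  shows "\<exists>g. smooth_fun_on UNIV g \<and> (\<forall>x. f x = of_real x * g x)"
proof -
  \<comment> \<open>Only \<open>G 0\<close> is wanted, but differentiating in \<open>x\<close>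
    brings out a factor \<open>t\<close>. The weight \<open>t ^ n\<close> closes the family: the
    derivative of \<open>G n F\<close> is \<open>G (Suc n) F'\<close>.\<close>
  define G where "G n F = (\<lambda>x. integral {0..1} (\<lambda>t. of_real t ^ n * F (t * x)))"
    for n and F :: "real \<Rightarrow> complex"
  have deriv: "(G n F has_vector_derivative G (Suc n) F' x) (at x)"
    if F: "\<And>x. (F has_vector_derivative F' x) (at x)" and "continuous_on UNIV F'" for n F F' x
  proof -
    have "continuous_on UNIV F"
      using F continuous_on_vector_derivative by blast
    have "((\<lambda>x. integral (cbox 0 1) (\<lambda>t. of_real t ^ n * F (t * x))) has_vector_derivative
       integral (cbox 0 1) (\<lambda>t. of_real t ^ Suc n * F' (t * x))) (at x within UNIV)"
    proof (rule leibniz_rule_vector_derivative)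
      show "((\<lambda>x. of_real t ^ n * F (t * x)) has_vector_derivative of_real t ^ Suc n * F' (t * x)) (at x)" for x t
      proof -
        have "((\<lambda>x. t * x) has_vector_derivative t) (at x)"
          by (auto intro!: derivative_eq_intros)
        then have "((F \<circ> (\<lambda>x. t * x)) has_vector_derivative t *\<^sub>R F' (t * x)) (at x)"
          using F by (intro vector_diff_chain_at)
        then have "((\<lambda>x. of_real t ^ n * (F \<circ> (\<lambda>x. t * x)) x) has_vector_derivative of_real t ^ n * (t *\<^sub>R F' (t * x))) (at x)"
          by (rule has_vector_derivative_mult_right)
        then show ?thesis by (simp add: o_def scaleR_conv_of_real ac_simps)
      qed
      show "(\<lambda>t. of_real t ^ n * F (t * x)) integrable_on cbox 0 1" for x
      proof -
        have "continuous_on (cbox 0 1) (\<lambda>t. F (t * x))"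
          by (rule continuous_on_compose2[OF \<open>continuous_on UNIV F\<close>]) (auto intro: continuous_intros)
        then show ?thesis by (intro integrable_continuous continuous_intros)
      qed
      show "continuous_on (UNIV \<times> cbox 0 1) (\<lambda>(x, t). of_real t ^ Suc n * F' (t * x))"
      proof -
        have "continuous_on (UNIV \<times> cbox 0 1) (\<lambda>p. F' (snd p * fst p))"
          by (rule continuous_on_compose2[OF \<open>continuous_on UNIV F'\<close>]) (auto intro!: continuous_intros)
        then show ?thesis unfolding split_def by (intro continuous_intros)
      qed
    qed auto
    then show ?thesis by (simp add: G_def)
  qed
  have G_C: "C_on k UNIV (G n F)" if "smooth_fun_on UNIV F" for k n F
    using that
  proof (induction k arbitrary: n F)
    case 0
    have "continuous_on UNIV (nth_deriv_on 1 UNIV F)"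
      using 0 C_on_0 smooth_fun_on_def smooth_fun_on_deriv(2) by blast
    then show ?case
      using deriv[OF smooth_fun_on_deriv(1)[OF 0]]
      by (auto simp: C_on_0 intro: continuous_on_vector_derivative)
  next
    case (Suc k)
    have "continuous_on UNIV (nth_deriv_on 1 UNIV F)"
      using Suc.prems C_on_0 smooth_fun_on_def smooth_fun_on_deriv(2) by blast
    then show ?case
      using Suc.IH[OF smooth_fun_on_deriv(2)[OF Suc.prems]] deriv[OF smooth_fun_on_deriv(1)[OF Suc.prems]]
      by (intro C_on_SucI[OF no_isolated_UNIV]) auto
  qed
  let ?f' = "nth_deriv_on 1 UNIV f"
  have "f x = of_real x * G 0 ?f' x" for x
  proof -
    have "((\<lambda>t. x *\<^sub>R ?f' (t * x)) has_integral (f \<circ> (\<lambda>t. t * x)) 1 - (f \<circ> (\<lambda>t. t * x)) 0) {0..1}"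
    proof (rule fundamental_theorem_of_calculus)
      fix t :: real
      have "((\<lambda>t. t * x) has_vector_derivative x) (at t)"
        by (auto intro!: derivative_eq_intros)
      then have "((f \<circ> (\<lambda>t. t * x)) has_vector_derivative x *\<^sub>R ?f' (t * x)) (at t)"
        using smooth_fun_on_deriv(1)[OF f] by (intro vector_diff_chain_at) auto
      then show "((f \<circ> (\<lambda>t. t * x)) has_vector_derivative x *\<^sub>R ?f' (t * x)) (at t within {0..1})"
        by (rule has_vector_derivative_at_within)
    qed simp
    from integral_unique[OF this]
    have "f x = integral {0..1} (\<lambda>t. x *\<^sub>R ?f' (t * x))"
      using \<open>f 0 = 0\<close> by (simp only: o_def mult_1 mult_zero_left diff_zero)
    also have "\<dots> = x *\<^sub>R integral {0..1} (\<lambda>t. ?f' (t * x))"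
      by (rule integral_cmul)
    finally show ?thesis by (simp add: G_def scaleR_conv_of_real)
  qed
  moreover have "smooth_fun_on UNIV (G 0 ?f')"
    using G_C smooth_fun_on_deriv(2)[OF f] unfolding smooth_fun_on_def by blast
  ultimately show ?thesis by blast
qed

section \<open>Rapidly decreasing functions on the punctured line\<close>

lemma rapidly_decreasing_iff:
  "rapidly_decreasing g \<longleftrightarrow> (\<forall>N::nat. ((\<lambda>y. \<bar>y\<bar> ^ N * norm (g y)) \<longlongrightarrow> 0) at_infinity)"
  unfolding rapidly_decreasing_def at_infinity_eq_at_top_bot
  by (meson filterlim_sup filterlim_mono order_refl sup_ge1 sup_ge2)

lemma eventually_at_infinity_gt: "\<forall>\<^sub>F y::real in at_infinity. a < \<bar>y\<bar>"
  unfolding eventually_at_infinity real_norm_def by (rule exI[of _ "a + 1"]) auto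

text \<open>Boundedness for the exponent \<open>Suc N\<close> gives the limit 0 for
  \<open>N\<close>, since one spare factor tends to infinity.\<close>

lemma rapidly_decreasing_boundI:
  assumes "\<And>N::nat. \<exists>C. \<forall>y. \<bar>y\<bar> ^ N * norm (g y) \<le> C"
  shows "rapidly_decreasing g"
  unfolding rapidly_decreasing_iff
proof
  fix N :: nat
  obtain C where C: "\<bar>y\<bar> ^ Suc N * norm (g y) \<le> C" for y
    using assms by blast
  show "((\<lambda>y. \<bar>y\<bar> ^ N * norm (g y)) \<longlongrightarrow> 0) at_infinity"
  proof (rule Lim_null_comparison)
    have "((\<lambda>y::real. C / y) \<longlongrightarrow> 0) at_infinity"
      by (rule tendsto_divide_0[OF tendsto_const filterlim_ident])
    then have "((\<lambda>y::real. \<bar>C / y\<bar>) \<longlongrightarrow> 0) at_infinity"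
      by (rule tendsto_rabs_zero)
    then show "((\<lambda>y::real. \<bar>C\<bar> / \<bar>y\<bar>) \<longlongrightarrow> 0) at_infinity"
      by simp
    show "\<forall>\<^sub>F y in at_infinity. norm (\<bar>y\<bar> ^ N * norm (g y)) \<le> \<bar>C\<bar> / \<bar>y\<bar>"
      using eventually_at_infinity_gt[of 0]
    proof eventually_elim
      case (elim y)
      have "\<bar>y\<bar> * (\<bar>y\<bar> ^ N * norm (g y)) \<le> \<bar>C\<bar>"
        using C[of y] by (simp add: ac_simps)
      then show ?case using elim by (simp add: field_simps abs_mult)
    qed
  qed
qed

text \<open>Polynomial losses are harmless because every exponent \<open>N\<close> is allowed: the
  factor \<open>\<bar>y\<bar> ^ m\<close> is absorbed by using \<open>N + m\<close> for
  \<open>f\<close>.\<close>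

lemma rapidly_decreasing_comparison:
  assumes "rapidly_decreasing f"
    and "\<forall>\<^sub>F y in at_infinity. norm (g y) \<le> C * \<bar>y\<bar> ^ m * norm (f y)"
  shows "rapidly_decreasing g"
  unfolding rapidly_decreasing_iff
proof
  fix N :: nat
  show "((\<lambda>y. \<bar>y\<bar> ^ N * norm (g y)) \<longlongrightarrow> 0) at_infinity"
  proof (rule Lim_null_comparison)
    show "((\<lambda>y. C * (\<bar>y\<bar> ^ (N + m) * norm (f y))) \<longlongrightarrow> 0) at_infinity"
      using assms(1) unfolding rapidly_decreasing_iff by (intro tendsto_mult_right_zero) auto
    show "\<forall>\<^sub>F y in at_infinity. norm (\<bar>y\<bar> ^ N * norm (g y)) \<le> C * (\<bar>y\<bar> ^ (N + m) * norm (f y))"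
      using assms(2)
    proof eventually_elim
      case (elim y)
      then have "\<bar>y\<bar> ^ N * norm (g y) \<le> \<bar>y\<bar> ^ N * (C * \<bar>y\<bar> ^ m * norm (f y))"
        by (intro mult_left_mono) auto
      then show ?case by (simp add: abs_mult power_add ac_simps)
    qed
  qed
qed

lemma rapidly_decreasing_cong:
  assumes "rapidly_decreasing f" "\<And>y. y \<noteq> 0 \<Longrightarrow> g y = f y"
  shows "rapidly_decreasing g"
proof (rule rapidly_decreasing_comparison[OF assms(1)])
  show "\<forall>\<^sub>F y in at_infinity. norm (g y) \<le> 1 * \<bar>y\<bar> ^ 0 * norm (f y)"
    using eventually_at_infinity_gt[of 0] by eventually_elim (use assms(2) in auto)
qed

lemma rapidly_decreasing_add:
  assumes "rapidly_decreasing f" "rapidly_decreasing g"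
  shows "rapidly_decreasing (\<lambda>y. f y + g y)"
  unfolding rapidly_decreasing_iff
proof
  fix N :: nat
  show "((\<lambda>y. \<bar>y\<bar> ^ N * norm (f y + g y)) \<longlongrightarrow> 0) at_infinity"
  proof (rule Lim_null_comparison)
    show "((\<lambda>y. \<bar>y\<bar> ^ N * norm (f y) + \<bar>y\<bar> ^ N * norm (g y)) \<longlongrightarrow> 0) at_infinity"
      using assms unfolding rapidly_decreasing_iff by (intro tendsto_add_zero) auto
    show "\<forall>\<^sub>F y in at_infinity. norm (\<bar>y\<bar> ^ N * norm (f y + g y)) \<le> \<bar>y\<bar> ^ N * norm (f y) + \<bar>y\<bar> ^ N * norm (g y)"
    proof (rule always_eventually, rule allI)
      fix y
      have "\<bar>y\<bar> ^ N * norm (f y + g y) \<le> \<bar>y\<bar> ^ N * (norm (f y) + norm (g y))"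
        by (intro mult_left_mono norm_triangle_ineq) auto
      then show "norm (\<bar>y\<bar> ^ N * norm (f y + g y)) \<le> \<bar>y\<bar> ^ N * norm (f y) + \<bar>y\<bar> ^ N * norm (g y)"
        by (simp add: abs_mult algebra_simps)
    qed
  qed
qed

lemma rapidly_decreasing_cmult:
  "rapidly_decreasing f \<Longrightarrow> rapidly_decreasing (\<lambda>y. c * f y)"
  by (rule rapidly_decreasing_comparison[where C = "norm c" and m = 0])
    (auto simp: norm_mult intro: always_eventually)

lemma rapidly_decreasing_mult_power:
  "rapidly_decreasing f \<Longrightarrow> rapidly_decreasing (\<lambda>y. of_real y ^ n * f y)"
  by (rule rapidly_decreasing_comparison[where C = 1 and m = n])
    (auto simp: norm_mult norm_power intro: always_eventually)

lemma rapidly_decreasing_divide: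
  assumes "rapidly_decreasing f"
  shows "rapidly_decreasing (\<lambda>y. f y / of_real y)"
proof (rule rapidly_decreasing_comparison[OF assms])
  show "\<forall>\<^sub>F y in at_infinity. norm (f y / of_real y) \<le> 1 * \<bar>y\<bar> ^ 0 * norm (f y)"
    using eventually_at_infinity_gt[of 1]
  proof eventually_elim
    case (elim y)
    have "norm (f y) * 1 \<le> norm (f y) * \<bar>y\<bar>"
      using elim by (intro mult_left_mono) auto
    then show ?case using elim by (simp add: norm_divide divide_le_eq)
  qed
qed

lemma rapidly_decreasing_powr:
  assumes "rapidly_decreasing f"
  shows "rapidly_decreasing (\<lambda>y. of_real (\<bar>y\<bar> powr a) * f y)"
proof (rule rapidly_decreasing_comparison[OF assms])
  define m where "m = nat \<lceil>a\<rceil>"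
  show "\<forall>\<^sub>F y in at_infinity. norm (of_real (\<bar>y\<bar> powr a) * f y) \<le> 1 * \<bar>y\<bar> ^ m * norm (f y)"
    using eventually_at_infinity_gt[of 1]
  proof eventually_elim
    case (elim y)
    have "a \<le> real m" unfolding m_def by linarith
    then have "\<bar>y\<bar> powr a \<le> \<bar>y\<bar> powr real m"
      using elim by (intro powr_mono) auto
    also have "\<dots> = \<bar>y\<bar> ^ m" using elim by (intro powr_realpow) auto
    finally show ?case by (simp add: norm_mult mult_right_mono)
  qed
qed

text \<open>A version truncated at order \<open>n\<close> of the two conditions on f in the theorem,
  so that \<open>rapid_SucI\<close> and \<open>rapid_SucD\<close> permit induction;
  \<open>rapid_smooth\<close> recovers the full conditions.\<close>

definition rapid :: "nat \<Rightarrow> (real \<Rightarrow> complex) \<Rightarrow> bool" where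
  "rapid n f \<longleftrightarrow> C_on n punctured_line f \<and>
     (\<forall>i\<le>n. rapidly_decreasing (nth_deriv_on i punctured_line f))"

lemma at_within_punctured_line: "x \<noteq> 0 \<Longrightarrow> at x within punctured_line = at x"
  by (rule at_within_open) auto

lemma rapid_0: "rapid 0 f \<longleftrightarrow> continuous_on punctured_line f \<and> rapidly_decreasing f"
  by (simp add: rapid_def C_on_0)

lemma rapid_SucI:
  assumes "rapidly_decreasing f"
    and "\<And>x. x \<noteq> 0 \<Longrightarrow> (f has_vector_derivative f' x) (at x)"
    and "rapid n f'"
  shows "rapid (Suc n) f"
proof -
  have f': "(f has_vector_derivative f' x) (at x within punctured_line)" if "x \<in> punctured_line" for x
    using assms(2) that by (simp add: has_vector_derivative_at_within)
  have "rapidly_decreasing (nth_deriv_on i punctured_line f)" if "i \<le> Suc n" for i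
  proof (cases i)
    case 0
    then show ?thesis using assms(1) by simp
  next
    case (Suc j)
    have "rapidly_decreasing (nth_deriv_on j punctured_line f')"
      using Suc that assms(3) by (simp add: rapid_def)
    then show ?thesis
      unfolding Suc
      by (rule rapidly_decreasing_cong) (use nth_deriv_on_Suc_eq[OF no_isolated_punctured_line f'] in blast)
  qed
  moreover have "C_on (Suc n) punctured_line f"
    using no_isolated_punctured_line f' assms(3) unfolding rapid_def by (blast intro: C_on_SucI)
  ultimately show ?thesis by (simp add: rapid_def)
qed

lemma rapid_SucD:
  assumes "rapid (Suc n) f"
  shows "rapidly_decreasing f"
    and "\<exists>f'. (\<forall>x. x \<noteq> 0 \<longrightarrow> (f has_vector_derivative f' x) (at x)) \<and> rapid n f'"
proof -
  show "rapidly_decreasing f" using assms unfolding rapid_def by (metis nth_deriv_on.simps(1) zero_le)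
  let ?f' = "nth_deriv_on 1 punctured_line f"
  have C: "C_on (Suc n) punctured_line f" using assms by (simp add: rapid_def)
  have "(f has_vector_derivative ?f' x) (at x)" if "x \<noteq> 0" for x
    using C_on_SucD(1)[OF C] that by (metis DiffI UNIV_I at_within_punctured_line singletonD)
  moreover have "rapid n ?f'"
    using C_on_SucD(2)[OF C] assms unfolding rapid_def
    by (metis Suc_le_mono nth_deriv_on_Suc_shift)
  ultimately show "\<exists>f'. (\<forall>x. x \<noteq> 0 \<longrightarrow> (f has_vector_derivative f' x) (at x)) \<and> rapid n f'"
    by blast
qed

lemma rapid_lessI: "rapid n f \<Longrightarrow> m \<le> n \<Longrightarrow> rapid m f"
  unfolding rapid_def using C_on_lessI[OF no_isolated_punctured_line] by fastforce

lemma rapid_cong: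
  assumes "rapid n f" "\<And>y. y \<noteq> 0 \<Longrightarrow> g y = f y"
  shows "rapid n g"
  unfolding rapid_def
proof (intro conjI allI impI)
  show "C_on n punctured_line g"
    using assms C_on_cong[of punctured_line g f] by (simp add: rapid_def)
  fix i assume "i \<le> n"
  then have "rapidly_decreasing (nth_deriv_on i punctured_line f)"
    using assms(1) by (simp add: rapid_def)
  then show "rapidly_decreasing (nth_deriv_on i punctured_line g)"
    by (rule rapidly_decreasing_cong) (use assms(2) in \<open>auto intro: nth_deriv_on_cong\<close>)
qed

lemma rapid_add:
  assumes "rapid n f" "rapid n g"
  shows "rapid n (\<lambda>y. f y + g y)"
  using assms
proof (induction n arbitrary: f g)
  case 0
  then show ?case by (simp add: rapid_0 rapidly_decreasing_add continuous_intros)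
next
  case (Suc n)
  obtain f' where f': "\<And>x. x \<noteq> 0 \<Longrightarrow> (f has_vector_derivative f' x) (at x)" "rapid n f'"
    using rapid_SucD(2)[OF Suc.prems(1)] by blast
  obtain g' where g': "\<And>x. x \<noteq> 0 \<Longrightarrow> (g has_vector_derivative g' x) (at x)" "rapid n g'"
    using rapid_SucD(2)[OF Suc.prems(2)] by blast
  show ?case
    using f' g' Suc by (intro rapid_SucI[where f' = "\<lambda>x. f' x + g' x"] rapidly_decreasing_add)
      (auto intro: has_vector_derivative_add rapid_SucD(1))
qed

lemma rapid_cmult:
  assumes "rapid n f"
  shows "rapid n (\<lambda>y. c * f y)"
  using assms
proof (induction n arbitrary: f)
  case 0
  then show ?case by (simp add: rapid_0 rapidly_decreasing_cmult continuous_intros)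
next
  case (Suc n)
  obtain f' where f': "\<And>x. x \<noteq> 0 \<Longrightarrow> (f has_vector_derivative f' x) (at x)" "rapid n f'"
    using rapid_SucD(2)[OF Suc.prems(1)] by blast
  show ?case
    using f' Suc by (intro rapid_SucI[where f' = "\<lambda>x. c * f' x"] rapidly_decreasing_cmult)
      (auto intro: has_vector_derivative_mult_right rapid_SucD(1))
qed

lemma rapid_diff:
  assumes "rapid n f" "rapid n g"
  shows "rapid n (\<lambda>y. f y - g y)"
  using rapid_add[OF assms(1) rapid_cmult[OF assms(2), of "- 1"]] by simp

section \<open>Division by y and multiplication by real powers of the absolute value\<close>

lemma has_vector_derivative_divide_id:
  fixes f :: "real \<Rightarrow> complex"
  assumes "(f has_vector_derivative f') (at x)" "x \<noteq> 0"
  shows "((\<lambda>y. f y / of_real y) has_vector_derivative (f' - f x / of_real x) / of_real x) (at x)"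
proof -
  have "((\<lambda>y. inverse (of_real y) :: complex) has_vector_derivative - inverse (of_real x ^ 2)) (at x)"
    by (rule has_vector_derivative_real_field)
       (use assms(2) in \<open>auto intro!: derivative_eq_intros simp: power2_eq_square\<close>)
  from has_vector_derivative_mult[OF assms(1) this]
  show ?thesis using assms(2)
    by (auto elim!: has_vector_derivative_eq_rhs simp: divide_inverse algebra_simps power2_eq_square)
qed

lemma rapid_divide:
  assumes "rapid n f"
  shows "rapid n (\<lambda>y. f y / of_real y)"
  using assms
proof (induction n arbitrary: f)
  case 0
  then show ?case by (auto simp: rapid_0 intro!: rapidly_decreasing_divide continuous_intros)
next
  case (Suc n)
  obtain f' where f': "\<And>x. x \<noteq> 0 \<Longrightarrow> (f has_vector_derivative f' x) (at x)" "rapid n f'"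
    using rapid_SucD(2)[OF Suc.prems(1)] by blast
  have "rapid n f" using Suc.prems by (rule rapid_lessI) simp
  then have "rapid n (\<lambda>y. (f' y - f y / of_real y) / of_real y)"
    using Suc.IH f'(2) by (intro Suc.IH rapid_diff)
  then show ?case
    using f'(1) rapid_SucD(1)[OF Suc.prems]
    by (intro rapid_SucI[OF rapidly_decreasing_divide, where f' = "\<lambda>y. (f' y - f y / of_real y) / of_real y"])
      (auto intro: has_vector_derivative_divide_id)
qed

lemma has_vector_derivative_abs_powr:
  assumes "x \<noteq> 0"
  shows "((\<lambda>y. complex_of_real (\<bar>y\<bar> powr a)) has_vector_derivative of_real (\<bar>x\<bar> powr a) * (of_real a / of_real x)) (at x)"
proof -
  have "((\<lambda>y. sgn x * y) has_real_derivative sgn x) (at x)"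
    by (auto intro!: derivative_eq_intros)
  then have "(abs has_real_derivative sgn x) (at x)"
    by (rule has_field_derivative_transform_within_open[where S = "if x > 0 then {0<..} else {..<0}"])
       (use assms in \<open>auto simp: sgn_if split: if_splits\<close>)
  then have "((\<lambda>y. \<bar>y\<bar> powr a) has_field_derivative (a * \<bar>x\<bar> powr (a - 1)) * sgn x) (at x)"
    by (rule DERIV_chain2[where f = "\<lambda>y. y powr a" and g = abs, rotated])
       (use assms in \<open>auto intro!: derivative_eq_intros\<close>)
  moreover have "(a * \<bar>x\<bar> powr (a - 1)) * sgn x = \<bar>x\<bar> powr a * (a / x)"
    using assms by (simp add: powr_diff sgn_if field_simps)
  ultimately have "((\<lambda>y. \<bar>y\<bar> powr a) has_field_derivative \<bar>x\<bar> powr a * (a / x)) (at x)"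
    by simp
  then show ?thesis
    by (rule has_vector_derivative_eq_rhs[OF has_vector_derivative_of_real]) simp
qed

text \<open>The derivative of \<open>\<bar>y\<bar> powr a * f y\<close> is
  \<open>\<bar>y\<bar> powr a\<close> times f' + a f / y. The weight keeps its exponent and the
  second factor stays in the class, so induction applies. Negative \<open>a\<close> is covered as
  well, since \<open>rapid\<close> imposes nothing near 0.\<close>

lemma rapid_powr:
  assumes "rapid n f"
  shows "rapid n (\<lambda>y. of_real (\<bar>y\<bar> powr a) * f y)"
  using assms
proof (induction n arbitrary: f)
  case 0
  then show ?case by (auto simp: rapid_0 intro!: rapidly_decreasing_powr continuous_intros)
next
  case (Suc n)
  obtain f' where f': "\<And>x. x \<noteq> 0 \<Longrightarrow> (f has_vector_derivative f' x) (at x)" "rapid n f'"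
    using rapid_SucD(2)[OF Suc.prems(1)] by blast
  have "rapid n f" using Suc.prems by (rule rapid_lessI) simp
  then have *: "rapid n (\<lambda>y. of_real (\<bar>y\<bar> powr a) * (f' y + of_real a * (f y / of_real y)))"
    using f'(2) by (intro Suc.IH rapid_add rapid_cmult rapid_divide)
  show ?case
  proof (rule rapid_SucI[OF rapidly_decreasing_powr _ *])
    show "rapidly_decreasing f" by (rule rapid_SucD(1)[OF Suc.prems])
    fix x :: real assume "x \<noteq> 0"
    from has_vector_derivative_mult[OF has_vector_derivative_abs_powr[OF this] f'(1)[OF this]]
    show "((\<lambda>y. of_real (\<bar>y\<bar> powr a) * f y) has_vector_derivative
        of_real (\<bar>x\<bar> powr a) * (f' x + of_real a * (f x / of_real x))) (at x)"
      by (rule has_vector_derivative_eq_rhs) (simp add: algebra_simps)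
  qed
qed

lemma rapid_smooth:
  "(\<forall>n. rapid n f) \<longleftrightarrow> smooth_fun_on punctured_line f \<and>
     (\<forall>n. rapidly_decreasing (nth_deriv_on n punctured_line f))"
  by (auto simp: rapid_def smooth_fun_on_def)

section \<open>The Fourier integral\<close>

text \<open>Sign and normalization are those of \<open>char\<close>, which gives access to the
  Gaussian. The exponent in \<open>M_op\<close> has the opposite sign, hence the reflections further
  on.\<close>

definition fourier :: "(real \<Rightarrow> complex) \<Rightarrow> real \<Rightarrow> complex" where
  "fourier w x = (LINT y|lborel. w y * exp (\<i> * of_real x * of_real y))"

lemma norm_character [simp]: "norm (exp (\<i> * of_real x * of_real y)) = 1"
  using norm_exp_i_times[of "x * y"] by (simp add: ac_simps)

lemma borel_measurable_character [measurable]: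
  "(\<lambda>y. exp (\<i> * of_real x * of_real y)) \<in> borel_measurable borel"
  by (intro borel_measurable_continuous_onI continuous_intros)

lemma integrable_mult_bounded:
  fixes f g :: "'a \<Rightarrow> complex"
  assumes "integrable M f" "g \<in> borel_measurable M" "\<And>x. norm (g x) \<le> C"
  shows "integrable M (\<lambda>x. f x * g x)"
proof (rule Bochner_Integration.integrable_bound)
  show "integrable M (\<lambda>x. of_real C * f x)" using assms(1) by simp
  show "AE x in M. norm (f x * g x) \<le> norm (of_real C * f x)"
  proof (rule AE_I2)
    fix x
    have "norm (g x) \<le> \<bar>C\<bar>" using assms(3)[of x] by linarith
    then show "norm (f x * g x) \<le> norm (of_real C * f x)"
      using mult_right_mono[of "norm (g x)" "\<bar>C\<bar>" "norm (f x)"] by (simp add: norm_mult mult.commute)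
  qed
qed (use assms in measurable)

lemma integrable_mult_character:
  "integrable lborel w \<Longrightarrow> integrable lborel (\<lambda>y. w y * exp (\<i> * of_real x * of_real y))"
  by (rule integrable_mult_bounded[where C = 1]) auto

lemma fourier_cmult: "fourier (\<lambda>y. c * w y) x = c * fourier w x"
  by (simp add: fourier_def mult.assoc)

lemma fourier_add:
  "integrable lborel v \<Longrightarrow> integrable lborel w \<Longrightarrow> fourier (\<lambda>y. v y + w y) x = fourier v x + fourier w x"
  unfolding fourier_def distrib_right by (intro Bochner_Integration.integral_add integrable_mult_character)

lemma norm_fourier_le: "integrable lborel w \<Longrightarrow> norm (fourier w x) \<le> (LINT y|lborel. norm (w y))"
  unfolding fourier_def
  by (rule order_trans[OF integral_norm_bound]) (simp add: norm_mult)

lemma continuous_on_fourier: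
  assumes "integrable lborel w"
  shows "continuous_on UNIV (fourier w)"
proof -
  have "isCont (fourier w) x" for x
    unfolding continuous_at_sequentially
  proof (intro allI impI)
    fix X assume X: "X \<longlonglongrightarrow> x"
    show "(fourier w \<circ> X) \<longlonglongrightarrow> fourier w x"
      unfolding o_def fourier_def
    proof (rule integral_dominated_convergence[where w = "\<lambda>y. norm (w y)"])
      show "AE y in lborel. (\<lambda>i. w y * exp (\<i> * of_real (X i) * of_real y)) \<longlonglongrightarrow>
          w y * exp (\<i> * of_real x * of_real y)"
        by (intro AE_I2 tendsto_intros X)
    qed (use assms in \<open>auto simp: norm_mult\<close>)
  qed
  then show ?thesis by (simp add: continuous_on_eq_continuous_at)
qed

text \<open>Dominated convergence for the difference quotients: since exp(\<i> s) - 1 has norm at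
  most \<bar>s\<bar>, the quotient at any increment is dominated by the norm of y w(y).\<close>

lemma has_vector_derivative_fourier:
  assumes w: "integrable lborel w" and yw: "integrable lborel (\<lambda>y. of_real y * w y)"
  shows "(fourier w has_vector_derivative fourier (\<lambda>y. \<i> * (of_real y * w y)) x) (at x)"
proof -
  let ?D = "fourier (\<lambda>y. \<i> * (of_real y * w y)) x"
  have "((\<lambda>z. (fourier w z - fourier w x) / of_real (z - x)) \<longlongrightarrow> ?D) (at x)"
    unfolding tendsto_at_iff_sequentially
  proof (intro allI impI)
    fix X :: "nat \<Rightarrow> real" assume "\<forall>i. X i \<in> UNIV - {x}" and lim: "X \<longlonglongrightarrow> x"
    then have X: "X i \<noteq> x" for i by auto
    have [measurable]: "w \<in> borel_measurable borel"
      using borel_measurable_integrable[OF w] by simp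
    let ?q = "\<lambda>i y. w y * ((exp (\<i> * of_real (X i) * of_real y) - exp (\<i> * of_real x * of_real y)) / of_real (X i - x))"
    have quot: "(fourier w (X i) - fourier w x) / of_real (X i - x) = (LINT y|lborel. ?q i y)" for i
      unfolding fourier_def
        Bochner_Integration.integral_diff[OF integrable_mult_character[OF w] integrable_mult_character[OF w], symmetric]
        integral_divide_zero[symmetric] right_diff_distrib[symmetric] times_divide_eq_right[symmetric] ..
    have "(\<lambda>i. LINT y|lborel. ?q i y) \<longlonglongrightarrow> (LINT y|lborel. \<i> * (of_real y * w y) * exp (\<i> * of_real x * of_real y))"
    proof (rule integral_dominated_convergence[where w = "\<lambda>y. norm (of_real y * w y)"])
      show "integrable lborel (\<lambda>y. norm (of_real y * w y))" using yw by simp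
      show "AE y in lborel. (\<lambda>i. ?q i y) \<longlonglongrightarrow> \<i> * (of_real y * w y) * exp (\<i> * of_real x * of_real y)"
      proof (rule AE_I2)
        fix y
        have "((\<lambda>z. exp (\<i> * z * of_real y)) has_field_derivative
            (\<i> * of_real y) * exp (\<i> * of_real x * of_real y)) (at (of_real x))"
          by (auto intro!: derivative_eq_intros)
        then have "((\<lambda>z. (exp (\<i> * z * of_real y) - exp (\<i> * of_real x * of_real y)) / (z - of_real x)) \<longlongrightarrow>
            (\<i> * of_real y) * exp (\<i> * of_real x * of_real y)) (at (of_real x))"
          by (simp add: has_field_derivative_iff)
        moreover have "filterlim (\<lambda>i. complex_of_real (X i)) (at (of_real x)) sequentially"
          using X lim by (auto simp: filterlim_at intro: tendsto_of_real)
        ultimately have "(\<lambda>i. (exp (\<i> * of_real (X i) * of_real y) - exp (\<i> * of_real x * of_real y)) / (of_real (X i) - of_real x))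
            \<longlonglongrightarrow> (\<i> * of_real y) * exp (\<i> * of_real x * of_real y)"
          by (rule filterlim_compose)
        from tendsto_mult_left[OF this, of "w y"]
        show "(\<lambda>i. ?q i y) \<longlonglongrightarrow> \<i> * (of_real y * w y) * exp (\<i> * of_real x * of_real y)"
          by (simp add: ac_simps)
      qed
      show "AE y in lborel. norm (?q i y) \<le> norm (of_real y * w y)" for i
      proof (rule AE_I2)
        fix y
        let ?s = "X i - x"
        have "exp (\<i> * of_real (X i) * of_real y) - exp (\<i> * of_real x * of_real y)
            = exp (\<i> * of_real x * of_real y) * (iexp (?s * y) - 1)"
          by (simp add: algebra_simps flip: exp_add)
        moreover have "norm (iexp (?s * y) - 1) \<le> \<bar>?s * y\<bar>"
          using iexp_approx1[of "?s * y" 0] by simp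
        ultimately have "norm (exp (\<i> * of_real (X i) * of_real y) - exp (\<i> * of_real x * of_real y)) \<le> \<bar>?s\<bar> * \<bar>y\<bar>"
          by (simp add: norm_mult abs_mult)
        then have "norm ((exp (\<i> * of_real (X i) * of_real y) - exp (\<i> * of_real x * of_real y)) / of_real ?s) \<le> \<bar>y\<bar>"
          using X[of i] by (simp add: norm_divide divide_le_eq mult.commute del: of_real_diff)
        from mult_left_mono[OF this norm_ge_zero[of "w y"]]
        show "norm (?q i y) \<le> norm (of_real y * w y)"
          by (simp only: norm_mult norm_of_real mult.commute)
      qed
    qed measurable
    then show "((\<lambda>z. (fourier w z - fourier w x) / of_real (z - x)) \<circ> X) \<longlonglongrightarrow> ?D"
      unfolding o_def quot by (simp only: fourier_def)
  qed
  then have "((\<lambda>z. norm ((fourier w z - fourier w x) / of_real (z - x) - ?D)) \<longlongrightarrow> 0) (at x)"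
    by (intro tendsto_norm_zero LIM_zero)
  moreover have "\<forall>\<^sub>F z in at x. norm ((fourier w z - fourier w x) / of_real (z - x) - ?D)
      = norm (fourier w z - fourier w x - (z - x) *\<^sub>R ?D) / norm (z - x)"
    unfolding eventually_at_filter
  proof (rule always_eventually, intro allI impI)
    fix z assume "z \<noteq> x"
    then have "(fourier w z - fourier w x) / of_real (z - x) - ?D
       = (fourier w z - fourier w x - (z - x) *\<^sub>R ?D) / of_real (z - x)"
      by (simp add: scaleR_conv_of_real divide_simps del: of_real_diff)
    then show "norm ((fourier w z - fourier w x) / of_real (z - x) - ?D)
      = norm (fourier w z - fourier w x - (z - x) *\<^sub>R ?D) / norm (z - x)"
      by (simp add: norm_divide del: of_real_diff)
  qed
  ultimately have "((\<lambda>z. norm (fourier w z - fourier w x - (z - x) *\<^sub>R ?D) / norm (z - x)) \<longlongrightarrow> 0) (at x)"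
    by (rule Lim_transform_eventually)
  then show ?thesis
    by (simp add: has_vector_derivative_def has_derivative_iff_norm bounded_linear_scaleR_left)
qed

section \<open>Gaussian regularization and Fourier inversion\<close>

lemma gaussian_fourier:
  "(LINT x|lborel. complex_of_real (std_normal_density x) * iexp (t * x)) = of_real (exp (- t\<^sup>2 / 2))"
proof -
  have "char std_normal_distribution t = (LINT x|lborel. std_normal_density x *\<^sub>R iexp (t * x))"
    unfolding char_def by (subst integral_density) auto
  then show ?thesis
    by (simp add: char_std_normal_distribution scaleR_conv_of_real)
qed

text \<open>The Gaussian factor makes the double integral absolutely convergent; letting its width
  grow recovers \<open>fourier (fourier h)\<close>, while Fubini's theorem turns the regularized integral into a
  Gaussian average of \<open>h\<close> around \<open>y\<close>.\<close>

lemma fourier_inversion: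
  assumes h: "integrable lborel h" and bound: "\<And>y. norm (h y) \<le> C"
    and Fh: "integrable lborel (fourier h)" and cont: "isCont h y"
  shows "fourier (fourier h) (- y) = 2 * of_real pi * h y"
proof -
  have [measurable]: "h \<in> borel_measurable borel" "fourier h \<in> borel_measurable borel"
    using borel_measurable_integrable[OF h] borel_measurable_integrable[OF Fh] by simp_all
  \<comment> \<open>A Gaussian of width \<open>Suc n\<close>, left unnormalized so that it converges
    pointwise to the constant \<open>std_normal_density 0\<close> = 1 / sqrt (2 pi), which is also a
    uniform bound.\<close>
  define g where "g n x = complex_of_real (std_normal_density (x / real (Suc n)))" for n x
  have [measurable]: "g n \<in> borel_measurable borel" for n
    unfolding g_def by measurable
  have density_le: "std_normal_density x \<le> 1 / sqrt (2 * pi)" for x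
    by (simp add: std_normal_density_def field_simps)
  have g_le: "norm (g n x) \<le> 1 / sqrt (2 * pi)" for n x
    using density_le by (simp add: g_def normal_density_nonneg)
  have g_int: "integrable lborel (g n)" for n
  proof -
    have "integrable lborel (\<lambda>x. complex_of_real (std_normal_density x))"
      using integrable_normal_density by (intro integrable_of_real) auto
    from lborel_integrable_real_affine[OF this, of "1 / real (Suc n)" 0]
    show ?thesis by (simp add: g_def[abs_def])
  qed
  let ?I = "\<lambda>n. LINT x|lborel. fourier h x * exp (\<i> * of_real (- y) * of_real x) * g n x"
  have lim1: "?I \<longlonglongrightarrow> (LINT x|lborel. fourier h x * exp (\<i> * of_real (- y) * of_real x) * of_real (std_normal_density 0))"
  proof (rule integral_dominated_convergence[where w = "\<lambda>x. norm (fourier h x) * (1 / sqrt (2 * pi))"])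
    show "integrable lborel (\<lambda>x. norm (fourier h x) * (1 / sqrt (2 * pi)))"
      using Fh by (intro integrable_mult_left integrable_norm) auto
    show "AE x in lborel. (\<lambda>n. fourier h x * exp (\<i> * of_real (- y) * of_real x) * g n x)
        \<longlonglongrightarrow> fourier h x * exp (\<i> * of_real (- y) * of_real x) * of_real (std_normal_density 0)"
    proof (rule AE_I2)
      fix x :: real
      have "(\<lambda>n. x / real (Suc n)) \<longlonglongrightarrow> 0"
        by real_asymp
      moreover have "isCont std_normal_density 0"
        unfolding normal_density_def by (intro continuous_intros) auto
      ultimately have "(\<lambda>n. std_normal_density (x / real (Suc n))) \<longlonglongrightarrow> std_normal_density 0"
        by (rule isCont_tendsto_compose[rotated])
      then show "(\<lambda>n. fourier h x * exp (\<i> * of_real (- y) * of_real x) * g n x)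
        \<longlonglongrightarrow> fourier h x * exp (\<i> * of_real (- y) * of_real x) * of_real (std_normal_density 0)"
        unfolding g_def by (intro tendsto_intros)
    qed
    show "AE x in lborel. norm (fourier h x * exp (\<i> * of_real (- y) * of_real x) * g n x)
        \<le> norm (fourier h x) * (1 / sqrt (2 * pi))" for n
    proof (rule AE_I2)
      fix x
      show "norm (fourier h x * exp (\<i> * of_real (- y) * of_real x) * g n x)
        \<le> norm (fourier h x) * (1 / sqrt (2 * pi))"
        using mult_left_mono[OF g_le norm_ge_zero]
        by (simp only: norm_mult norm_character mult_1_right)
    qed
  qed measurable
  have I_eq: "?I n = (LINT u|lborel. h (y + u / real (Suc n)) * of_real (exp (- u\<^sup>2 / 2)))" for n
  proof -
    define m where "m = real (Suc n)"
    have "m > 0" by (simp add: m_def)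
    let ?K = "\<lambda>x s. h s * exp (\<i> * of_real x * of_real s) * (exp (\<i> * of_real (- y) * of_real x) * g n x)"
    have "integrable (lborel \<Otimes>\<^sub>M lborel) (\<lambda>(x, s). ?K x s)"
    proof (rule lborel_pair.Fubini_integrable)
      show "(\<lambda>(x, s). ?K x s) \<in> borel_measurable (lborel \<Otimes>\<^sub>M lborel)"
      proof -
        have "(\<lambda>p. exp (\<i> * complex_of_real (fst p) * of_real (snd p))) \<in> borel_measurable (borel :: (real \<times> real) measure)"
          by (intro borel_measurable_continuous_onI continuous_intros)
        then have [measurable]: "(\<lambda>p. exp (\<i> * complex_of_real (fst p) * of_real (snd p))) \<in> borel_measurable (borel \<Otimes>\<^sub>M (borel :: real measure))"
          by (simp add: borel_prod)
        show ?thesis unfolding split_def by measurable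
      qed
      have "(LINT s|lborel. norm (?K x s)) = norm (g n x) * (LINT s|lborel. norm (h s))" for x
        by (simp add: norm_mult mult.commute norm_character[of "-y" x, simplified])
      then show "integrable lborel (\<lambda>x. LINT s|lborel. norm (case (x, s) of (x, s) \<Rightarrow> ?K x s))"
        using g_int by simp
      show "AE x in lborel. integrable lborel (\<lambda>s. case (x, s) of (x, s) \<Rightarrow> ?K x s)"
        using integrable_mult_character[OF h] by simp
    qed
    from lborel_pair.Fubini_integral[OF this]
    have "(LINT s|lborel. LINT x|lborel. ?K x s) = (LINT x|lborel. LINT s|lborel. ?K x s)"
      by simp
    also have "\<dots> = ?I n"
    proof -
      have "(LINT s|lborel. ?K x s) = fourier h x * (exp (\<i> * of_real (- y) * of_real x) * g n x)" for x
        unfolding fourier_def by (rule integral_mult_left_zero)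
      then show ?thesis by (simp only: mult.assoc)
    qed
    finally have "?I n = (LINT s|lborel. LINT x|lborel. ?K x s)" ..
    \<comment> \<open>The inner integral is the transform of a Gaussian of width \<open>m\<close>,
      hence \<open>m\<close> times a Gaussian in \<open>m * (s - y)\<close>. The substitution s = y
      + u / m then absorbs the factor \<open>m\<close>.\<close>
    also have "\<dots> = (LINT s|lborel. h s * (of_real m * of_real (exp (- (m * (s - y))\<^sup>2 / 2))))"
    proof (rule Bochner_Integration.integral_cong[OF refl])
      fix s
      have "(LINT x|lborel. ?K x s) = h s * (LINT x|lborel. of_real (std_normal_density (x / m)) * iexp ((s - y) * x))"
      proof -
        have "exp (\<i> * of_real x * of_real s) * exp (\<i> * of_real (- y) * of_real x) = iexp ((s - y) * x)" for x
          by (simp add: algebra_simps flip: exp_add)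
        then have "?K x s = h s * (of_real (std_normal_density (x / m)) * iexp ((s - y) * x))" for x
          by (simp add: g_def m_def mult.assoc[symmetric])
        then show ?thesis by (simp only: integral_mult_right_zero)
      qed
      also have "(LINT x|lborel. of_real (std_normal_density (x / m)) * iexp ((s - y) * x))
         = of_real m * (LINT x|lborel. of_real (std_normal_density x) * iexp ((m * (s - y)) * x))"
        using \<open>m > 0\<close>
        by (subst lborel_integral_real_affine[where c = m and t = 0]) (simp_all add: scaleR_conv_of_real ac_simps)
      finally show "(LINT x|lborel. ?K x s) = h s * (of_real m * of_real (exp (- (m * (s - y))\<^sup>2 / 2)))"
        by (simp only: gaussian_fourier)
    qed
    also have "\<dots> = (LINT u|lborel. h (y + u / m) * of_real (exp (- u\<^sup>2 / 2)))"
      using \<open>m > 0\<close>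
      by (subst lborel_integral_real_affine[where c = "1 / m" and t = y])
         (simp_all add: scaleR_conv_of_real ac_simps flip: Bochner_Integration.integral_mult_right_zero)
    finally show ?thesis by (simp add: m_def)
  qed
  have gauss: "(LINT u|lborel. complex_of_real (exp (- u\<^sup>2 / 2))) = of_real (sqrt (2 * pi))"
    and gauss_int: "integrable lborel (\<lambda>u. exp (- u\<^sup>2 / 2) :: real)"
  proof -
    have *: "exp (- u\<^sup>2 / 2) = sqrt (2 * pi) * std_normal_density u" for u :: real
      by (simp add: std_normal_density_def)
    show "integrable lborel (\<lambda>u. exp (- u\<^sup>2 / 2) :: real)"
      unfolding * using integrable_normal_density by (intro integrable_mult_right) auto
    have "(LINT u|lborel. sqrt (2 * pi) * std_normal_density u) = sqrt (2 * pi)"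
      using integral_normal_density[of 1 0] by simp
    then show "(LINT u|lborel. complex_of_real (exp (- u\<^sup>2 / 2))) = of_real (sqrt (2 * pi))"
      unfolding * integral_complex_of_real by simp
  qed
  have "?I \<longlonglongrightarrow> (LINT u|lborel. h y * of_real (exp (- u\<^sup>2 / 2)))"
    unfolding I_eq
  proof (rule integral_dominated_convergence[where w = "\<lambda>u. C * exp (- u\<^sup>2 / 2)"])
    show "integrable lborel (\<lambda>u. C * exp (- u\<^sup>2 / 2))"
      using gauss_int by simp
    show "AE u in lborel. (\<lambda>n. h (y + u / real (Suc n)) * of_real (exp (- u\<^sup>2 / 2))) \<longlonglongrightarrow> h y * of_real (exp (- u\<^sup>2 / 2))"
    proof (rule AE_I2)
      fix u :: real
      have "(\<lambda>n. y + u / real (Suc n)) \<longlonglongrightarrow> y" by real_asymp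
      with cont have "(\<lambda>n. h (y + u / real (Suc n))) \<longlonglongrightarrow> h y"
        by (rule isCont_tendsto_compose)
      then show "(\<lambda>n. h (y + u / real (Suc n)) * of_real (exp (- u\<^sup>2 / 2))) \<longlonglongrightarrow> h y * of_real (exp (- u\<^sup>2 / 2))"
        by (intro tendsto_intros)
    qed
    show "AE u in lborel. norm (h (y + u / real (Suc n)) * of_real (exp (- u\<^sup>2 / 2))) \<le> C * exp (- u\<^sup>2 / 2)" for n
      using bound by (intro AE_I2) (simp add: norm_mult mult_right_mono)
  qed measurable
  \<comment> \<open>The constant 2 pi is a product of two factors sqrt (2 pi): one is the inverse of
    the density at 0, the other the total mass of exp(- u^2 / 2).\<close>
  from LIMSEQ_unique[OF lim1 this]
  have "fourier (fourier h) (- y) * of_real (std_normal_density 0) = h y * of_real (sqrt (2 * pi))"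
    by (simp only: fourier_def[of "fourier h"] integral_mult_left_zero integral_mult_right_zero gauss)
  then have "fourier (fourier h) (- y) = h y * of_real (sqrt (2 * pi)) * of_real (sqrt (2 * pi))"
    by (simp add: std_normal_density_def field_simps)
  also have "\<dots> = h y * of_real (sqrt (2 * pi) * sqrt (2 * pi))"
    by (simp only: of_real_mult mult.assoc)
  finally show ?thesis by simp
qed

text \<open>The fundamental theorem of calculus for w(y) exp(\<i> x y) on each open half-line.
  Nothing survives at infinity, and the two contributions at 0 leave the jump
  \<open>lm - lp\<close>. These jumps are the coefficients of the later expansion.\<close>

lemma fourier_by_parts:
  assumes w: "integrable lborel w" and w': "integrable lborel w'"
    and deriv: "\<And>y. y \<noteq> 0 \<Longrightarrow> (w has_vector_derivative w' y) (at y)"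
    and cont: "continuous_on punctured_line w'"
    and lims: "(w \<longlongrightarrow> lp) (at_right 0)" "(w \<longlongrightarrow> lm) (at_left 0)" "(w \<longlongrightarrow> 0) at_infinity"
  shows "\<i> * of_real x * fourier w x + fourier w' x = lm - lp"
proof -
  define E where "E y = exp (\<i> * of_real x * of_real y)" for y :: real
  define f where "f y = \<i> * of_real x * (w y * E y) + w' y * E y" for y
  have E: "(E has_vector_derivative \<i> * of_real x * E y) (at y)" for y
    unfolding E_def by (rule has_vector_derivative_real_field) (auto intro!: derivative_eq_intros)
  have Ec: "isCont E y" for y unfolding E_def by (intro continuous_intros)
  have F: "((\<lambda>y. w y * E y) has_vector_derivative f y) (at y)" if "y \<noteq> 0" for y
    using has_vector_derivative_mult[OF deriv[OF that] E]
    by (rule has_vector_derivative_eq_rhs) (simp add: f_def algebra_simps)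
  have fc: "isCont f y" if "y \<noteq> 0" for y
  proof -
    have "isCont w' y"
      using cont that by (simp add: continuous_on_eq_continuous_at open_delete)
    moreover have "isCont w y" using deriv[OF that] by (rule has_vector_derivative_continuous)
    ultimately show ?thesis unfolding f_def using Ec by (intro continuous_intros)
  qed
  have int1: "integrable lborel (\<lambda>y. w y * E y)" "integrable lborel (\<lambda>y. w' y * E y)"
    unfolding E_def by (intro integrable_mult_character w w')+
  then have int: "integrable lborel f" unfolding f_def by (intro Bochner_Integration.integrable_add integrable_mult_right)
  have sint: "set_integrable lborel A f" if "A \<in> sets borel" for A
    unfolding set_integrable_def using int that by (intro integrable_mult_indicator) auto
  have E0: "((\<lambda>y. w y * E y) \<longlongrightarrow> 0) F" if "(w \<longlongrightarrow> 0) F" for F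
    using that by (subst tendsto_norm_zero_iff[symmetric]) (simp add: E_def norm_mult tendsto_norm_zero)
  have E1: "((\<lambda>y. w y * E y) \<longlongrightarrow> l) (at 0 within S)" if "(w \<longlongrightarrow> l) (at 0 within S)" for l S
  proof -
    have "(E \<longlongrightarrow> E 0) (at 0 within S)"
      using Ec[of 0] unfolding isCont_def by (rule tendsto_within_subset) simp
    from tendsto_mult[OF that this] show ?thesis by (simp add: E_def)
  qed
  have "(LBINT y=0..\<infinity>. f y) = 0 - lp"
  proof (rule interval_integral_FTC_integrable[where F = "\<lambda>y. w y * E y"])
    show "(((\<lambda>y. w y * E y) \<circ> real_of_ereal) \<longlongrightarrow> lp) (at_right 0)"
      using E1[OF lims(1)] by (simp add: zero_ereal_def ereal_tendsto_simps)
    show "(((\<lambda>y. w y * E y) \<circ> real_of_ereal) \<longlongrightarrow> 0) (at_left \<infinity>)"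
      using E0[OF tendsto_mono[OF at_top_le_at_infinity lims(3)]] by (simp add: ereal_tendsto_simps)
  qed (use F fc sint in \<open>auto simp: zero_ereal_def\<close>)
  moreover have "(LBINT y=-\<infinity>..0. f y) = lm - 0"
  proof (rule interval_integral_FTC_integrable[where F = "\<lambda>y. w y * E y"])
    show "(((\<lambda>y. w y * E y) \<circ> real_of_ereal) \<longlongrightarrow> lm) (at_left 0)"
      using E1[OF lims(2)] by (simp add: zero_ereal_def ereal_tendsto_simps)
    show "(((\<lambda>y. w y * E y) \<circ> real_of_ereal) \<longlongrightarrow> 0) (at_right (-\<infinity>))"
      using E0[OF tendsto_mono[OF at_bot_le_at_infinity lims(3)]] by (simp add: ereal_tendsto_simps)
  qed (use F fc sint in \<open>auto simp: zero_ereal_def\<close>)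
  moreover have "(LBINT y=-\<infinity>..0. f y) + (LBINT y=0..\<infinity>. f y) = (LBINT y=-\<infinity>..\<infinity>. f y)"
    by (rule interval_integral_sum) (simp add: interval_lebesgue_integrable_def sint)
  moreover have "(LBINT y=-\<infinity>..\<infinity>. f y) = (LINT y|lborel. f y)"
    by (simp add: interval_lebesgue_integral_def set_lebesgue_integral_def)
  moreover have "(LINT y|lborel. f y) = \<i> * of_real x * fourier w x + fourier w' x"
    unfolding f_def using int1
    by (subst Bochner_Integration.integral_add) (auto simp: fourier_def E_def)
  ultimately show ?thesis by simp
qed

section \<open>The spaces \<open>I_space\<close>\<close>

text \<open>The bound \<open>C / (1 + y\<^sup>2)\<close> serves as common decay condition
  throughout: it gives integrability here, the limit 0 in
  \<open>tendsto_inverse_square_decay\<close> and boundedness in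
  \<open>inverse_square_decay_bounded\<close>.\<close>

lemma integrable_inverse_square_decay:
  fixes w :: "real \<Rightarrow> complex"
  assumes "w \<in> borel_measurable borel" "\<And>y. norm (w y) \<le> C / (1 + y\<^sup>2)"
  shows "integrable lborel w"
proof (rule Bochner_Integration.integrable_bound)
  have "integrable lborel (\<lambda>y::real. inverse (1 + y\<^sup>2))"
    using integrable_inverse_1_plus_square by (simp add: set_integrable_def)
  then show "integrable lborel (\<lambda>y::real. C * inverse (1 + y\<^sup>2))" by simp
  show "AE y in lborel. norm (w y) \<le> norm (C * inverse (1 + y\<^sup>2))"
    by (rule AE_I2) (use assms(2) in \<open>simp add: divide_inverse order_trans[OF _ abs_ge_self]\<close>)
qed (use assms(1) in simp)

lemma tendsto_inverse_square_decay:
  fixes w :: "real \<Rightarrow> complex"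
  assumes "\<And>y. norm (w y) \<le> C / (1 + y\<^sup>2)"
  shows "(w \<longlongrightarrow> 0) at_infinity"
proof (rule Lim_null_comparison)
  show "\<forall>\<^sub>F y in at_infinity. norm (w y) \<le> C / (1 + y\<^sup>2)"
    using assms by simp
  have "((\<lambda>y::real. C / (1 + y\<^sup>2)) \<longlongrightarrow> 0) at_top" "((\<lambda>y::real. C / (1 + y\<^sup>2)) \<longlongrightarrow> 0) at_bot"
    by real_asymp+
  then show "((\<lambda>y::real. C / (1 + y\<^sup>2)) \<longlongrightarrow> 0) at_infinity"
    by (simp add: at_infinity_eq_at_top_bot filterlim_def filtermap_sup)
qed

text \<open>(1 + y^2) times the norm of w is small near infinity, bounded near 0 by the one-sided
  limits, and continuous on the compact set in between.\<close>

lemma rapidly_decreasing_decay: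
  assumes cont: "continuous_on punctured_line w" and "rapidly_decreasing w"
    and lims: "(w \<longlongrightarrow> lp) (at_right 0)" "(w \<longlongrightarrow> lm) (at_left 0)"
  shows "\<exists>C. \<forall>y. norm (w y) \<le> C / (1 + y\<^sup>2)"
proof -
  define v where "v y = (1 + y\<^sup>2) * norm (w y)" for y
  have "((\<lambda>y. \<bar>y\<bar> ^ 0 * norm (w y) + \<bar>y\<bar> ^ 2 * norm (w y)) \<longlongrightarrow> 0) at_infinity"
    using assms(2)[unfolded rapidly_decreasing_iff] by (intro tendsto_add_zero) blast+
  then have "(v \<longlongrightarrow> 0) at_infinity"
    by (simp add: v_def[abs_def] algebra_simps)
  then have "\<forall>\<^sub>F y in at_infinity. v y < 1"
    by (rule order_tendstoD) simp
  then obtain B where B: "v y < 1" if "B \<le> \<bar>y\<bar>" for y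
    unfolding eventually_at_infinity by auto
  have "(v \<longlongrightarrow> (1 + 0\<^sup>2) * norm lp) (at_right 0)" "(v \<longlongrightarrow> (1 + 0\<^sup>2) * norm lm) (at_left 0)"
    unfolding v_def[abs_def] by (intro tendsto_intros lims)+
  then have "\<forall>\<^sub>F y in at_right 0. v y < norm lp + norm lm + 1" "\<forall>\<^sub>F y in at_left 0. v y < norm lp + norm lm + 1"
    by (auto elim!: order_tendstoD(2) simp: add_nonneg_pos)
  then have "\<forall>\<^sub>F y in at 0. v y < norm lp + norm lm + 1"
    by (simp add: eventually_at_split)
  then obtain b where b: "b > 0" "\<And>y. y \<noteq> 0 \<Longrightarrow> \<bar>y\<bar> < b \<Longrightarrow> v y < norm lp + norm lm + 1"
    unfolding eventually_at by (auto simp: dist_real_def)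
  have "compact (cball 0 B - ball (0::real) b)"
    by (intro compact_diff) auto
  moreover have "continuous_on (cball 0 B - ball 0 b) v"
    unfolding v_def[abs_def] using b(1)
    by (auto intro!: continuous_intros continuous_on_subset[OF cont])
  ultimately have "bounded (v ` (cball 0 B - ball 0 b))"
    by (intro compact_imp_bounded compact_continuous_image)
  then obtain C where "\<And>y. y \<in> cball 0 B - ball 0 b \<Longrightarrow> \<bar>v y\<bar> \<le> C"
    unfolding bounded_iff real_norm_def by blast
  then have C: "v y \<le> C" if "b \<le> \<bar>y\<bar>" "\<bar>y\<bar> \<le> B" for y
    using that abs_le_D1 by fastforce
  \<comment> \<open>One entry per region: far out, close to 0, the compact middle, and the point 0
    itself, where the value of \<open>w\<close> is unrelated to the limits.\<close>
  define M where "M = Max {1, norm lp + norm lm + 1, C, norm (w 0)}"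
  have M: "1 \<le> M" "norm lp + norm lm + 1 \<le> M" "C \<le> M" "norm (w 0) \<le> M"
    unfolding M_def by (auto intro: Max_ge)
  have "v y \<le> M" for y
  proof -
    consider "y = 0" | "y \<noteq> 0" "\<bar>y\<bar> < b" | "B \<le> \<bar>y\<bar>" | "b \<le> \<bar>y\<bar>" "\<bar>y\<bar> \<le> B" by linarith
    then show ?thesis
    proof cases
      case 1 then show ?thesis using M(4) by (simp add: v_def)
    next
      case 2 then show ?thesis using b(2)[of y] M(2) by linarith
    next
      case 3 then show ?thesis using B[of y] M(1) by linarith
    next
      case 4 then show ?thesis using C[of y] M(3) by linarith
    qed
  qed
  then have "norm (w y) \<le> M / (1 + y\<^sup>2)" for y
    by (subst pos_le_divide_eq) (auto simp: v_def mult.commute intro: add_pos_nonneg)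
  then show ?thesis by blast
qed

lemma borel_measurable_continuous_on_punctured_line:
  "continuous_on punctured_line w \<Longrightarrow> (w :: real \<Rightarrow> complex) \<in> borel_measurable borel"
  by (rule borel_measurable_continuous_countable_exceptions[of "{0}"]) (simp_all add: Compl_eq_Diff_UNIV)

lemma C_on_reflect:
  assumes "C_on k UNIV f"
  shows "C_on k UNIV (\<lambda>x. f (- x))"
  using assms
proof (induction k arbitrary: f)
  case 0
  then show ?case
    by (auto simp: C_on_0 intro!: continuous_intros elim: continuous_on_compose2)
next
  case (Suc k)
  obtain f' where f': "\<And>x. (f has_vector_derivative f' x) (at x)" "C_on k UNIV f'"
    using C_on_SucD[OF Suc.prems] by blast
  have "((\<lambda>x. f (- x)) has_vector_derivative - 1 * f' (- x)) (at x)" for x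
  proof -
    have "((\<lambda>x::real. - x) has_vector_derivative - 1) (at x)"
      by (auto intro!: derivative_eq_intros)
    from vector_diff_chain_at[OF this f'(1)] show ?thesis by (simp add: o_def)
  qed
  moreover have "C_on k UNIV (\<lambda>x. - 1 * f' (- x))"
    by (rule C_on_cmult[OF no_isolated_UNIV Suc.IH[OF f'(2)]])
  ultimately show ?case
    by (intro C_on_SucI[OF no_isolated_UNIV]) auto
qed

text \<open>With the negative power cleared, \<open>\<psi>\<close> describes \<open>\<phi>\<close>
  in the chart at infinity, and \<open>\<psi> 0\<close> is the leading coefficient of its
  decay.\<close>

lemma I_space_iff:
  "\<phi> \<in> I_space d \<longleftrightarrow> smooth_fun_on UNIV \<phi> \<and>
     (\<exists>\<psi>. smooth_fun_on UNIV \<psi> \<and> (\<forall>x. x \<noteq> 0 \<longrightarrow> \<phi> (- 1 / x) = of_real x ^ Suc d * \<psi> x))"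
proof -
  have "complex_of_real (x powi (- int d - 1)) = inverse (of_real x ^ Suc d)" for x
  proof -
    have "- int d - 1 = - int (Suc d)" by simp
    then have "x powi (- int d - 1) = inverse (x ^ Suc d)"
      by (simp only: power_int_minus power_int_of_nat)
    then show ?thesis by simp
  qed
  then have "(\<psi> x = of_real (x powi (- int d - 1)) * \<phi> (- 1 / x)) = (\<phi> (- 1 / x) = of_real x ^ Suc d * \<psi> x)"
    if "x \<noteq> 0" for x \<psi>
    using that by (auto simp add: field_simps simp del: power_Suc)
  then show ?thesis unfolding I_space_def by simp
qed

lemma I_spaceD: "\<phi> \<in> I_space d \<Longrightarrow> smooth_fun_on UNIV \<phi>"
  by (simp add: I_space_iff)

lemma smooth_continuous_on: "smooth_fun_on S f \<Longrightarrow> continuous_on S f"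
  by (simp add: smooth_fun_on_def flip: C_on_0)

text \<open>Compactness in two charts: \<open>\<phi>\<close> is bounded for \<bar>x\<bar> up to 1,
  and \<open>\<psi>\<close> is bounded at u = - 1 / x otherwise. There the factor u^(d + 1) is at
  most u^2 in size because d is positive.\<close>

lemma I_space_decay:
  assumes "\<phi> \<in> I_space d" "d > 0"
  shows "\<exists>C. \<forall>x. norm (\<phi> x) \<le> C / (1 + x\<^sup>2)"
proof -
  obtain \<psi> where \<phi>: "smooth_fun_on UNIV \<phi>" and \<psi>: "smooth_fun_on UNIV \<psi>"
    and eq: "\<And>x. x \<noteq> 0 \<Longrightarrow> \<phi> (- 1 / x) = of_real x ^ Suc d * \<psi> x"
    using assms(1) unfolding I_space_iff by blast
  have bdd: "\<exists>B\<ge>0. \<forall>x. \<bar>x\<bar> \<le> 1 \<longrightarrow> norm (f x) \<le> B" if "smooth_fun_on UNIV f" for f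
  proof -
    have "bounded (f ` {-1..1})"
      using smooth_continuous_on[OF that]
      by (intro compact_imp_bounded compact_continuous_image) (auto intro: continuous_on_subset)
    then obtain B where B: "\<And>x. x \<in> {-1..1} \<Longrightarrow> norm (f x) \<le> B"
      unfolding bounded_iff by blast
    then show ?thesis
      using order_trans[OF norm_ge_zero B[of 0]] by (intro exI[of _ B]) (auto simp: abs_le_iff)
  qed
  obtain B1 where B1: "B1 \<ge> 0" "\<And>x. \<bar>x\<bar> \<le> 1 \<Longrightarrow> norm (\<phi> x) \<le> B1" using bdd[OF \<phi>] by blast
  obtain B2 where B2: "B2 \<ge> 0" "\<And>x. \<bar>x\<bar> \<le> 1 \<Longrightarrow> norm (\<psi> x) \<le> B2" using bdd[OF \<psi>] by blast
  have "norm (\<phi> x) * (1 + x\<^sup>2) \<le> 2 * (B1 + B2)" for x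
  proof (cases "\<bar>x\<bar> \<le> 1")
    case True
    have "norm (\<phi> x) * (1 + x\<^sup>2) \<le> B1 * 2"
      using B1 True by (intro mult_mono) (auto simp: abs_square_le_1)
    also have "\<dots> \<le> 2 * (B1 + B2)" using B2(1) by simp
    finally show ?thesis .
  next
    case False
    define u where "u = - 1 / x"
    have u: "\<bar>u\<bar> \<le> 1" "u \<noteq> 0" "\<phi> x = of_real u ^ Suc d * \<psi> u"
      using eq[of u] False by (auto simp: u_def)
    have "\<bar>u\<bar> ^ Suc d \<le> \<bar>u\<bar> ^ 2"
      using u(1) assms(2) by (intro power_decreasing) auto
    then have "norm (\<phi> x) \<le> u\<^sup>2 * B2"
      using B2 u(1) by (simp add: u(3) norm_mult norm_power mult_mono del: power_Suc)
    moreover have "1 + x\<^sup>2 \<le> 2 * x\<^sup>2"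
      using False abs_le_square_iff[of 1 x] by simp
    ultimately have "norm (\<phi> x) * (1 + x\<^sup>2) \<le> (u\<^sup>2 * B2) * (2 * x\<^sup>2)"
      using B2(1) by (intro mult_mono) auto
    also have "\<dots> = 2 * B2" using False by (auto simp: u_def power_divide)
    also have "\<dots> \<le> 2 * (B1 + B2)" using B1(1) by simp
    finally show ?thesis .
  qed
  then have "norm (\<phi> x) \<le> 2 * (B1 + B2) / (1 + x\<^sup>2)" for x
    by (subst pos_le_divide_eq) (auto intro: add_pos_nonneg)
  then show ?thesis by blast
qed

lemma I_space_integrable:
  assumes "\<phi> \<in> I_space d" "d > 0"
  shows "integrable lborel \<phi>"
proof -
  have "\<phi> \<in> borel_measurable borel"
    using smooth_continuous_on[OF I_spaceD[OF assms(1)]] by (rule borel_measurable_continuous_onI)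
  then show ?thesis
    using I_space_decay[OF assms] integrable_inverse_square_decay by blast
qed

lemma smooth_add: "no_isolated S \<Longrightarrow> smooth_fun_on S f \<Longrightarrow> smooth_fun_on S g \<Longrightarrow> smooth_fun_on S (\<lambda>x. f x + g x)"
  by (simp add: smooth_fun_on_def C_on_add)

lemma smooth_cmult: "no_isolated S \<Longrightarrow> smooth_fun_on S f \<Longrightarrow> smooth_fun_on S (\<lambda>x. c * f x)"
  by (simp add: smooth_fun_on_def C_on_cmult)

lemma smooth_mult_id: "no_isolated S \<Longrightarrow> smooth_fun_on S f \<Longrightarrow> smooth_fun_on S (\<lambda>x. of_real x * f x)"
  by (simp add: smooth_fun_on_def C_on_mult C_on_of_real)

lemma has_vector_derivative_minus_inverse:
  assumes "\<And>x. (F has_vector_derivative F' x) (at x)" "x \<noteq> 0"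
  shows "((\<lambda>x. F (- 1 / x)) has_vector_derivative (1 / x\<^sup>2) *\<^sub>R F' (- 1 / x)) (at x)"
proof -
  have "((\<lambda>x. - 1 / x) has_vector_derivative 1 / x\<^sup>2) (at x)"
    using assms(2) by (auto intro!: derivative_eq_intros simp: power2_eq_square
        simp flip: has_real_derivative_iff_has_vector_derivative)
  from vector_diff_chain_at[OF this assms(1)] show ?thesis by (simp only: o_def)
qed

lemma has_vector_derivative_of_real_power:
  "((\<lambda>x. complex_of_real x ^ Suc n) has_vector_derivative of_nat (Suc n) * of_real x ^ n) (at x)"
  by (rule has_vector_derivative_real_field)
     (auto intro!: derivative_eq_intros simp del: power_Suc of_nat_Suc)

text \<open>Differentiating the identity in the chart at infinity and multiplying by x^2 produces
  x^(d + 2) times x \<psi>'(x) + (d + 1) \<psi>(x); the bracket is the new smooth factor.\<close>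

lemma I_space_deriv:
  assumes "\<phi> \<in> I_space d"
  shows "nth_deriv_on 1 UNIV \<phi> \<in> I_space (Suc d)"
proof -
  obtain \<psi> where \<phi>: "smooth_fun_on UNIV \<phi>" and \<psi>: "smooth_fun_on UNIV \<psi>"
    and eq: "\<And>x. x \<noteq> 0 \<Longrightarrow> \<phi> (- 1 / x) = of_real x ^ Suc d * \<psi> x"
    using assms unfolding I_space_iff by blast
  let ?\<phi>' = "nth_deriv_on 1 UNIV \<phi>" and ?\<psi>' = "nth_deriv_on 1 UNIV \<psi>"
  note d\<phi> = smooth_fun_on_deriv(1)[OF \<phi> UNIV_I] and d\<psi> = smooth_fun_on_deriv(1)[OF \<psi> UNIV_I]
  have "?\<phi>' (- 1 / x) = of_real x ^ Suc (Suc d) * (of_real x * ?\<psi>' x + of_nat (Suc d) * \<psi> x)" if "x \<noteq> 0" for x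
  proof -
    have "((\<lambda>x. \<phi> (- 1 / x)) has_vector_derivative (1 / x\<^sup>2) *\<^sub>R ?\<phi>' (- 1 / x)) (at x)"
      by (rule has_vector_derivative_minus_inverse[OF d\<phi> that])
    then have 1: "((\<lambda>x. of_real x ^ Suc d * \<psi> x) has_vector_derivative (1 / x\<^sup>2) *\<^sub>R ?\<phi>' (- 1 / x)) (at x)"
      by (rule has_vector_derivative_transform_within_open[where S = punctured_line]) (use eq that in auto)
    from has_vector_derivative_mult[OF has_vector_derivative_of_real_power d\<psi>] 1
    have "(1 / x\<^sup>2) *\<^sub>R ?\<phi>' (- 1 / x) = of_real x ^ Suc d * ?\<psi>' x + of_nat (Suc d) * of_real x ^ d * \<psi> x"
      by (rule vector_derivative_unique_at[rotated])
    then have "of_real (x\<^sup>2) * ((1 / x\<^sup>2) *\<^sub>R ?\<phi>' (- 1 / x))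
        = of_real (x\<^sup>2) * (of_real x ^ Suc d * ?\<psi>' x + of_nat (Suc d) * of_real x ^ d * \<psi> x)"
      by (simp only:)
    moreover have "of_real (x\<^sup>2) * ((1 / x\<^sup>2) *\<^sub>R ?\<phi>' (- 1 / x)) = ?\<phi>' (- 1 / x)"
      using that by (simp add: scaleR_conv_of_real del: nth_deriv_on.simps)
    moreover have "of_real (x\<^sup>2) * (of_real x ^ Suc d * ?\<psi>' x + of_nat (Suc d) * of_real x ^ d * \<psi> x)
       = of_real x ^ Suc (Suc d) * (of_real x * ?\<psi>' x + of_nat (Suc d) * \<psi> x)"
      by (simp add: power2_eq_square algebra_simps del: nth_deriv_on.simps of_nat_Suc)
    ultimately show ?thesis by (simp only:)
  qed
  moreover have "smooth_fun_on UNIV (\<lambda>x. of_real x * ?\<psi>' x + of_nat (Suc d) * \<psi> x)"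
    by (intro smooth_add smooth_mult_id smooth_cmult no_isolated_UNIV \<psi> smooth_fun_on_deriv(2))
  ultimately show ?thesis
    unfolding I_space_iff using smooth_fun_on_deriv(2)[OF \<phi>] by blast
qed

lemma I_space_mult_id:
  assumes "\<phi> \<in> I_space (Suc d)"
  shows "(\<lambda>x. of_real x * \<phi> x) \<in> I_space d"
proof -
  obtain \<psi> where \<phi>: "smooth_fun_on UNIV \<phi>" and \<psi>: "smooth_fun_on UNIV \<psi>"
    and eq: "\<And>x. x \<noteq> 0 \<Longrightarrow> \<phi> (- 1 / x) = of_real x ^ Suc (Suc d) * \<psi> x"
    using assms unfolding I_space_iff by blast
  have "of_real (- 1 / x) * \<phi> (- 1 / x) = of_real x ^ Suc d * (- 1 * \<psi> x)" if "x \<noteq> 0" for x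
    unfolding eq[OF that] using that by simp
  moreover have "smooth_fun_on UNIV (\<lambda>x. of_real x * \<phi> x)" "smooth_fun_on UNIV (\<lambda>x. - 1 * \<psi> x)"
    by (intro smooth_mult_id smooth_cmult no_isolated_UNIV \<phi> \<psi>)+
  ultimately show ?thesis unfolding I_space_iff by blast
qed

text \<open>Compensates the sign in \<open>M_op\<close>, which evaluates \<open>fourier\<close> at
  \<open>- y\<close>, that is, transforms the reflected function.\<close>

lemma I_space_reflect:
  assumes "\<phi> \<in> I_space d"
  shows "(\<lambda>x. \<phi> (- x)) \<in> I_space d"
proof -
  obtain \<psi> where \<phi>: "smooth_fun_on UNIV \<phi>" and \<psi>: "smooth_fun_on UNIV \<psi>"
    and eq: "\<And>x. x \<noteq> 0 \<Longrightarrow> \<phi> (- 1 / x) = of_real x ^ Suc d * \<psi> x"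
    using assms unfolding I_space_iff by blast
  have "\<phi> (- (- 1 / x)) = of_real x ^ Suc d * ((- 1) ^ Suc d * \<psi> (- x))" if "x \<noteq> 0" for x
    using eq[of "- x"] that power_minus[of "complex_of_real x" "Suc d"]
    by (simp add: ac_simps del: power_Suc)
  moreover have "smooth_fun_on UNIV (\<lambda>x. \<phi> (- x))" "smooth_fun_on UNIV (\<lambda>x. (- 1) ^ Suc d * \<psi> (- x))"
    using \<phi> \<psi> unfolding smooth_fun_on_def
    by (intro allI C_on_cmult no_isolated_UNIV C_on_reflect, blast)+
  ultimately show ?thesis unfolding I_space_iff by blast
qed

text \<open>The characteristic function of the Gamma distribution of shape d + 1, with its only
  singularity at - \<i>. The affine term is spelled out in the shape required by
  \<open>C_on_inverse_affine_power\<close>.\<close>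

definition pole :: "nat \<Rightarrow> real \<Rightarrow> complex" where
  "pole d x = inverse ((1 + (- \<i>) * of_real x) ^ Suc d)"

lemma affine_neq_0: "1 + (- \<i>) * complex_of_real x \<noteq> 0" "\<i> + 1 * complex_of_real x \<noteq> 0"
  by (auto simp: complex_eq_iff)

lemma pole_reflect:
  assumes "x \<noteq> 0"
  shows "pole d (- 1 / x) = of_real x ^ Suc d * inverse ((\<i> + 1 * of_real x) ^ Suc d)"
proof -
  have "1 + (- \<i>) * complex_of_real (- 1 / x) = (\<i> + 1 * of_real x) / of_real x"
    using assms by (simp add: field_simps)
  then show ?thesis
    by (simp only: pole_def power_divide inverse_divide) (simp only: divide_inverse)
qed

lemma pole_in_I_space: "pole d \<in> I_space d"
  unfolding I_space_iff
proof (intro conjI exI allI impI)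
  show "smooth_fun_on UNIV (pole d)"
    unfolding smooth_fun_on_def pole_def[abs_def]
    using affine_neq_0(1) by (intro allI C_on_inverse_affine_power no_isolated_UNIV)
  show "smooth_fun_on UNIV (\<lambda>x. inverse ((\<i> + 1 * of_real x) ^ Suc d))"
    unfolding smooth_fun_on_def
    using affine_neq_0(2) by (intro allI C_on_inverse_affine_power no_isolated_UNIV)
qed (rule pole_reflect)

text \<open>Cancelling the leading coefficient at infinity makes the smooth factor vanish at 0;
  Hadamard's lemma then extracts one more power of x.\<close>

lemma I_space_subtract_pole:
  assumes "\<phi> \<in> I_space d"
  shows "\<exists>c. (\<lambda>x. \<phi> x + c * pole d x) \<in> I_space (Suc d)"
proof -
  obtain \<psi> where \<phi>: "smooth_fun_on UNIV \<phi>" and \<psi>: "smooth_fun_on UNIV \<psi>"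
    and eq: "\<And>x. x \<noteq> 0 \<Longrightarrow> \<phi> (- 1 / x) = of_real x ^ Suc d * \<psi> x"
    using assms unfolding I_space_iff by blast
  define \<eta> where "\<eta> x = inverse ((\<i> + 1 * complex_of_real x) ^ Suc d)" for x
  have \<eta>: "smooth_fun_on UNIV \<eta>"
    unfolding smooth_fun_on_def \<eta>_def[abs_def]
    using affine_neq_0(2) by (intro allI C_on_inverse_affine_power no_isolated_UNIV)
  have "\<eta> 0 \<noteq> 0" by (simp add: \<eta>_def)
  \<comment> \<open>\<open>\<eta>\<close> is the smooth factor of \<open>pole d\<close>, so this is
    the multiple that kills the leading coefficient of \<open>\<phi>\<close>.\<close>
  define c where "c = - \<psi> 0 / \<eta> 0"
  have "smooth_fun_on UNIV (\<lambda>x. \<psi> x + c * \<eta> x)"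
    by (intro smooth_add smooth_cmult no_isolated_UNIV \<psi> \<eta>)
  moreover have "\<psi> 0 + c * \<eta> 0 = 0" using \<open>\<eta> 0 \<noteq> 0\<close> by (simp add: c_def)
  ultimately obtain g where g: "smooth_fun_on UNIV g" "\<And>x. \<psi> x + c * \<eta> x = of_real x * g x"
    using smooth_divide_by_id by blast
  have "\<phi> (- 1 / x) + c * pole d (- 1 / x) = of_real x ^ Suc (Suc d) * g x" if "x \<noteq> 0" for x
  proof -
    have "\<phi> (- 1 / x) + c * pole d (- 1 / x) = of_real x ^ Suc d * (\<psi> x + c * \<eta> x)"
      unfolding eq[OF that] pole_reflect[OF that] \<eta>_def by (simp only: distrib_left mult.left_commute)
    then show ?thesis by (simp add: g(2) ac_simps)
  qed
  moreover have "smooth_fun_on UNIV (\<lambda>x. \<phi> x + c * pole d x)"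
    by (intro smooth_add smooth_cmult no_isolated_UNIV \<phi> I_spaceD[OF pole_in_I_space])
  ultimately show ?thesis unfolding I_space_iff using g(1) by blast
qed

section \<open>Fourier transforms of elements of \<open>I_space\<close>\<close>

lemma inverse_square_decay_bounded:
  fixes w :: "real \<Rightarrow> complex"
  assumes "\<And>y. norm (w y) \<le> C / (1 + y\<^sup>2)"
  shows "norm (w y) \<le> \<bar>C\<bar>"
proof -
  have "norm (w y) \<le> \<bar>C\<bar> / (1 + y\<^sup>2)"
    using assms by (rule order_trans) (intro divide_right_mono, auto)
  also have "\<dots> \<le> \<bar>C\<bar>" by (simp add: divide_le_eq add_pos_nonneg algebra_simps)
  finally show ?thesis .
qed

lemma fourier_I_space_deriv:
  assumes "\<phi> \<in> I_space d" "d > 0"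
  shows "fourier (nth_deriv_on 1 UNIV \<phi>) x = - \<i> * of_real x * fourier \<phi> x"
proof -
  let ?\<phi>' = "nth_deriv_on 1 UNIV \<phi>"
  note \<phi> = I_spaceD[OF assms(1)] and \<phi>' = I_spaceD[OF I_space_deriv[OF assms(1)]]
  have "isCont \<phi> 0"
    using smooth_continuous_on[OF \<phi>] by (simp add: continuous_on_eq_continuous_at)
  then have lims: "(\<phi> \<longlongrightarrow> \<phi> 0) (at_right 0)" "(\<phi> \<longlongrightarrow> \<phi> 0) (at_left 0)"
    unfolding isCont_def by (auto intro: tendsto_within_subset)
  have "(\<phi> \<longlongrightarrow> 0) at_infinity"
    using I_space_decay[OF assms] tendsto_inverse_square_decay by blast
  moreover have "continuous_on punctured_line ?\<phi>'"
    using smooth_continuous_on[OF \<phi>'] by (rule continuous_on_subset) simp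
  ultimately have "\<i> * of_real x * fourier \<phi> x + fourier ?\<phi>' x = \<phi> 0 - \<phi> 0"
    using smooth_fun_on_deriv(1)[OF \<phi> UNIV_I] lims
      I_space_integrable[OF assms] I_space_integrable[OF I_space_deriv[OF assms(1)]]
    by (intro fourier_by_parts) auto
  then show ?thesis by (simp add: add_eq_0_iff2 del: nth_deriv_on.simps)
qed

lemma fourier_I_space_has_derivative:
  assumes "\<phi> \<in> I_space (Suc d)" "d > 0"
  shows "(fourier \<phi> has_vector_derivative \<i> * fourier (\<lambda>y. of_real y * \<phi> y) x) (at x)"
  unfolding fourier_cmult[symmetric]
  by (intro has_vector_derivative_fourier I_space_integrable[OF assms(1)]
      I_space_integrable[OF I_space_mult_id[OF assms(1)] assms(2)]) simp

text \<open>The source of the d - 1 continuous derivatives at 0. Each derivative multiplies by x and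
  lowers the index by one, and the last function must still be integrable, so the index may only
  drop to 1.\<close>

lemma C_on_fourier_I_space:
  "\<phi> \<in> I_space (Suc n) \<Longrightarrow> C_on n UNIV (fourier \<phi>)"
proof (induction n arbitrary: \<phi>)
  case 0
  then show ?case by (simp add: C_on_0 continuous_on_fourier I_space_integrable)
next
  case (Suc n)
  show ?case
    using fourier_I_space_has_derivative[OF Suc.prems] C_on_cmult[OF no_isolated_UNIV Suc.IH[OF I_space_mult_id[OF Suc.prems]]]
    by (intro C_on_SucI[OF no_isolated_UNIV, where f' = "\<lambda>x. \<i> * fourier (\<lambda>y. of_real y * \<phi> y) x"]) auto
qed

text \<open>A factor y amounts to one derivative of \<open>\<phi>\<close>, which stays within the
  \<open>I_space\<close> family; after \<open>N\<close> of them the L1 bound applies.\<close>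

lemma rapidly_decreasing_fourier_I_space:
  assumes "\<phi> \<in> I_space d" "d > 0"
  shows "rapidly_decreasing (fourier \<phi>)"
proof (rule rapidly_decreasing_boundI)
  fix N :: nat
  show "\<exists>C. \<forall>y. \<bar>y\<bar> ^ N * norm (fourier \<phi> y) \<le> C"
    using assms
  proof (induction N arbitrary: d \<phi>)
    case 0
    then show ?case using norm_fourier_le[OF I_space_integrable[OF 0]] by auto
  next
    case (Suc N)
    have "\<bar>y\<bar> ^ Suc N * norm (fourier \<phi> y) = \<bar>y\<bar> ^ N * norm (fourier (nth_deriv_on 1 UNIV \<phi>) y)" for y
      unfolding fourier_I_space_deriv[OF Suc.prems] by (simp add: norm_mult)
    with Suc.IH[OF I_space_deriv[OF Suc.prems(1)] zero_less_Suc] show ?case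
      by (simp only:)
  qed
qed

text \<open>Differentiating the transform of \<open>\<phi>\<close> directly would need x \<phi>
  integrable, which may fail for d = 1. It is instead written as \<i> G / y with G the transform of
  \<phi>'. The derivative of G involves x \<phi>', which lies in \<open>I_space d\<close> again, so
  the index never drops.\<close>

lemma rapid_fourier_I_space:
  assumes "\<phi> \<in> I_space d" "d > 0"
  shows "rapid n (fourier \<phi>)"
  using assms
proof (induction n arbitrary: d \<phi>)
  case 0
  have "continuous_on punctured_line (fourier \<phi>)"
    using continuous_on_fourier[OF I_space_integrable[OF 0]] by (rule continuous_on_subset) simp
  then show ?case using rapidly_decreasing_fourier_I_space[OF 0] by (simp add: rapid_0)
next
  case (Suc n)
  let ?\<phi>' = "nth_deriv_on 1 UNIV \<phi>"
  define G where "G = fourier ?\<phi>'"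
  define H where "H y = \<i> * fourier (\<lambda>x. of_real x * ?\<phi>' x) y" for y
  note \<phi>' = I_space_deriv[OF Suc.prems(1)]
  have "rapid n G" unfolding G_def by (rule Suc.IH[OF \<phi>']) simp
  moreover have "rapid n H"
    unfolding H_def[abs_def] by (intro rapid_cmult Suc.IH[OF I_space_mult_id[OF \<phi>'] Suc.prems(2)])
  ultimately have "rapid n (\<lambda>y. \<i> * ((H y - G y / of_real y) / of_real y))"
    by (intro rapid_cmult rapid_divide rapid_diff)
  moreover have "(fourier \<phi> has_vector_derivative \<i> * ((H y - G y / of_real y) / of_real y)) (at y)"
    if "y \<noteq> 0" for y
  proof (rule has_vector_derivative_transform_within_open)
    have "(G has_vector_derivative H y) (at y)"
      unfolding G_def H_def by (rule fourier_I_space_has_derivative[OF \<phi>' Suc.prems(2)])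
    then show "((\<lambda>y. \<i> * (G y / of_real y)) has_vector_derivative \<i> * ((H y - G y / of_real y) / of_real y)) (at y)"
      using that by (intro has_vector_derivative_mult_right has_vector_derivative_divide_id)
    show "\<i> * (G y / of_real y) = fourier \<phi> y" if "y \<in> punctured_line" for y
      unfolding G_def fourier_I_space_deriv[OF Suc.prems] using that by simp
  qed (use that in auto)
  ultimately show ?case
    by (intro rapid_SucI[OF rapidly_decreasing_fourier_I_space[OF Suc.prems]])
qed

text \<open>The Gamma density of shape d + 1 without its normalization 1 / d!. The value 0 at 0
  makes it continuous there exactly when d is positive.\<close>

definition half_gamma :: "nat \<Rightarrow> real \<Rightarrow> complex" where
  "half_gamma d y = (if y > 0 then of_real (y ^ d * exp (- y)) else 0)"

lemma half_gamma_lims: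
  "(half_gamma d \<longlongrightarrow> (if d = 0 then 1 else 0)) (at_right 0)" "(half_gamma d \<longlongrightarrow> 0) (at_left 0)"
proof -
  have "((\<lambda>y::real. y ^ d * exp (- y)) \<longlongrightarrow> 0 ^ d * exp (- 0)) (at_right 0)"
    by (intro tendsto_intros)
  then have "((\<lambda>y. complex_of_real (y ^ d * exp (- y))) \<longlongrightarrow> of_real (0 ^ d * exp (- 0))) (at_right 0)"
    by (rule tendsto_of_real)
  moreover have "\<forall>\<^sub>F y in at_right 0. complex_of_real (y ^ d * exp (- y)) = half_gamma d y"
    by (simp add: eventually_at_filter half_gamma_def)
  ultimately have "(half_gamma d \<longlongrightarrow> of_real (0 ^ d * exp (- 0))) (at_right 0)"
    by (rule Lim_transform_eventually)
  then show "(half_gamma d \<longlongrightarrow> (if d = 0 then 1 else 0)) (at_right 0)"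
    by (cases "d = 0") (simp_all add: power_0_left)
  have "\<forall>\<^sub>F y in at_left 0. half_gamma d y = 0"
    by (simp add: eventually_at_filter half_gamma_def)
  then show "(half_gamma d \<longlongrightarrow> 0) (at_left 0)"
    by (rule tendsto_eventually)
qed

text \<open>For d = 0 the truncated \<open>d - 1\<close> is harmless, its coefficient being 0. The
  factor \<open>(- 1)\<close> is kept explicit so that \<open>fourier_cmult\<close> applies.\<close>

lemma half_gamma_has_derivative:
  assumes "y \<noteq> 0"
  shows "(half_gamma d has_vector_derivative of_nat d * half_gamma (d - 1) y + (- 1) * half_gamma d y) (at y)"
proof (cases "y > 0")
  case True
  have "((\<lambda>y. y ^ d * exp (- y)) has_field_derivative real d * (y ^ (d - 1) * exp (- y)) - y ^ d * exp (- y)) (at y)"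
    by (auto intro!: derivative_eq_intros simp: algebra_simps)
  from has_vector_derivative_of_real[OF this]
  have "((\<lambda>y. complex_of_real (y ^ d * exp (- y))) has_vector_derivative
      of_nat d * half_gamma (d - 1) y + (- 1) * half_gamma d y) (at y)"
    by (rule has_vector_derivative_eq_rhs) (use True in \<open>simp add: half_gamma_def\<close>)
  then show ?thesis
    by (rule has_vector_derivative_transform_within_open[where S = "{0<..}"])
       (use True in \<open>auto simp: half_gamma_def\<close>)
next
  case False
  have "((\<lambda>y. 0) has_vector_derivative of_nat d * half_gamma (d - 1) y + (- 1) * half_gamma d y) (at y)"
    using False by (simp add: half_gamma_def)
  then show ?thesis
    by (rule has_vector_derivative_transform_within_open[where S = "{..<0}"])
       (use False assms in \<open>auto simp: half_gamma_def\<close>)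
qed

lemma continuous_on_half_gamma: "continuous_on punctured_line (half_gamma d)"
proof -
  have "isCont (half_gamma d) y" if "y \<noteq> 0" for y
    using half_gamma_has_derivative[OF that] by (rule has_vector_derivative_continuous)
  then show ?thesis by (auto intro: continuous_at_imp_continuous_on)
qed

lemma rapidly_decreasing_half_gamma: "rapidly_decreasing (half_gamma d)"
  unfolding rapidly_decreasing_def
proof (intro allI conjI)
  fix N :: nat
  have "((\<lambda>y::real. y ^ (N + d) / exp y) \<longlongrightarrow> 0) at_top"
    by (rule tendsto_power_div_exp_0)
  moreover have "\<forall>\<^sub>F y::real in at_top. y ^ (N + d) / exp y = \<bar>y\<bar> ^ N * norm (half_gamma d y)"
    using eventually_gt_at_top[of 0]
  proof eventually_elim
    case (elim y)
    then have "norm (half_gamma d y) = \<bar>y ^ d * exp (- y)\<bar>"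
      by (simp only: half_gamma_def if_True norm_of_real)
    then show ?case using elim by (simp add: power_add exp_minus field_simps)
  qed
  ultimately show "((\<lambda>y. \<bar>y\<bar> ^ N * norm (half_gamma d y)) \<longlongrightarrow> 0) at_top"
    by (rule Lim_transform_eventually)
  show "((\<lambda>y. \<bar>y\<bar> ^ N * norm (half_gamma d y)) \<longlongrightarrow> 0) at_bot"
    by (rule tendsto_eventually)
       (use eventually_le_at_bot[of 0] in eventually_elim, simp add: half_gamma_def)
qed

lemma half_gamma_decay: "\<exists>C. \<forall>y. norm (half_gamma d y) \<le> C / (1 + y\<^sup>2)"
  by (rule rapidly_decreasing_decay[OF continuous_on_half_gamma rapidly_decreasing_half_gamma half_gamma_lims])

lemma integrable_half_gamma: "integrable lborel (half_gamma d)"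
  using half_gamma_decay integrable_inverse_square_decay
    borel_measurable_continuous_on_punctured_line[OF continuous_on_half_gamma] by blast

text \<open>Integration by parts gives (1 - \<i> x) F_(d+1) = (d + 1) F_d for the transforms F_d.
  The recursion starts from (1 - \<i> x) F_0 = 1, where the 1 is the jump of exp(- y) at 0.\<close>

lemma fourier_half_gamma: "fourier (half_gamma d) x = fact d * pole d x"
proof (induction d)
  case 0
  have "\<i> * of_real x * fourier (half_gamma 0) x + fourier (\<lambda>y. (- 1) * half_gamma 0 y) x = 0 - 1"
  proof (rule fourier_by_parts)
    show "continuous_on punctured_line (\<lambda>y. (- 1) * half_gamma 0 y)"
      by (intro continuous_intros continuous_on_half_gamma)
    show "(half_gamma 0 \<longlongrightarrow> 0) at_infinity"
      using half_gamma_decay tendsto_inverse_square_decay by blast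
    show "(half_gamma 0 \<longlongrightarrow> 1) (at_right 0)" using half_gamma_lims(1)[of 0] by simp
  qed (use half_gamma_has_derivative[of _ 0] integrable_half_gamma half_gamma_lims in auto)
  then have "(1 + (- \<i>) * of_real x) * fourier (half_gamma 0) x = 1"
    unfolding fourier_cmult by (simp add: algebra_simps)
  then show ?case
    using affine_neq_0(1)[of x] by (simp add: pole_def inverse_eq_divide nonzero_eq_divide_eq mult.commute)
next
  case (Suc d)
  have "\<i> * of_real x * fourier (half_gamma (Suc d)) x +
      fourier (\<lambda>y. of_nat (Suc d) * half_gamma d y + (- 1) * half_gamma (Suc d) y) x = 0 - 0"
  proof (rule fourier_by_parts)
    show "continuous_on punctured_line (\<lambda>y. of_nat (Suc d) * half_gamma d y + (- 1) * half_gamma (Suc d) y)"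
      by (intro continuous_intros continuous_on_half_gamma)
    show "(half_gamma (Suc d) \<longlongrightarrow> 0) at_infinity"
      using half_gamma_decay tendsto_inverse_square_decay by blast
    show "(half_gamma (Suc d) \<longlongrightarrow> 0) (at_right 0)" using half_gamma_lims(1)[of "Suc d"] by simp
    show "(half_gamma (Suc d) has_vector_derivative of_nat (Suc d) * half_gamma d y + (- 1) * half_gamma (Suc d) y) (at y)"
      if "y \<noteq> 0" for y using half_gamma_has_derivative[OF that, of "Suc d"] by simp
  qed (use integrable_half_gamma half_gamma_lims in auto)
  then have "\<i> * of_real x * fourier (half_gamma (Suc d)) x + (of_nat (Suc d) * (fact d * pole d x)
      + (- 1) * fourier (half_gamma (Suc d)) x) = 0"
    by (subst (asm) fourier_add) (simp_all only: fourier_cmult integrable_mult_right integrable_half_gamma Suc.IH diff_0_right)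
  then have *: "(1 + (- \<i>) * of_real x) * fourier (half_gamma (Suc d)) x = of_nat (Suc d) * (fact d * pole d x)"
    by (simp add: algebra_simps)
  have "fourier (half_gamma (Suc d)) x = of_nat (Suc d) * (fact d * pole d x) / (1 + (- \<i>) * of_real x)"
    using affine_neq_0(1)[of x] by (subst *[symmetric]) simp
  also have "\<dots> = fact (Suc d) * pole (Suc d) x"
    by (simp add: pole_def divide_inverse)
  finally show ?case .
qed

text \<open>Inversion applied to \<open>fourier_half_gamma\<close>. Positivity of d makes
  \<open>pole d\<close> integrable and \<open>half_gamma d\<close> continuous at 0, so the formula
  holds at every \<open>y\<close>, including the endpoint of both half-lines.\<close>

lemma fourier_pole:
  assumes "d > 0"
  shows "fourier (pole d) y = 2 * of_real pi / fact d * half_gamma d (- y)"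
proof -
  have "isCont (half_gamma d) z" for z
  proof (cases "z = 0")
    case True
    have "(half_gamma d \<longlongrightarrow> 0) (at_right 0)" "(half_gamma d \<longlongrightarrow> 0) (at_left 0)"
      using half_gamma_lims[of d] assms by auto
    then have "(half_gamma d \<longlongrightarrow> half_gamma d 0) (at 0)"
      by (simp add: filterlim_at_split half_gamma_def)
    then show ?thesis using True by (simp add: isCont_def)
  next
    case False
    then show ?thesis using half_gamma_has_derivative has_vector_derivative_continuous by blast
  qed
  moreover obtain C where "\<And>y. norm (half_gamma d y) \<le> C / (1 + y\<^sup>2)"
    using half_gamma_decay by blast
  then have "norm (half_gamma d y) \<le> \<bar>C\<bar>" for y
    by (rule inverse_square_decay_bounded)
  moreover have "fourier (half_gamma d) = (\<lambda>x. fact d * pole d x)"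
    by (rule ext) (rule fourier_half_gamma)
  moreover have "integrable lborel (\<lambda>x. fact d * pole d x)"
    by (intro integrable_mult_right I_space_integrable[OF pole_in_I_space assms])
  ultimately have "fourier (\<lambda>x. fact d * pole d x) (- (- y)) = 2 * of_real pi * half_gamma d (- y)"
    using fourier_inversion[OF integrable_half_gamma, of d "\<bar>C\<bar>" "- y"] by simp
  then show ?thesis by (simp add: fourier_cmult field_simps)
qed

lemma C_on_power_exp:
  assumes "no_isolated S"
  shows "C_on k S (\<lambda>y. of_real (- y) ^ d * of_real (exp y))"
proof -
  have "C_on k S (\<lambda>y. complex_of_real (exp y))"
  proof (induction k)
    case 0
    then show ?case by (auto simp: C_on_0 intro!: continuous_intros)
  next
    case (Suc k)
    have "((\<lambda>y. complex_of_real (exp y)) has_vector_derivative of_real (exp y)) (at y within S)" for y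
      by (rule has_vector_derivative_of_real) (rule DERIV_exp[THEN has_field_derivative_at_within])
    then show ?case using Suc by (intro C_on_SucI[OF assms])
  qed
  moreover have "C_on k S (\<lambda>y. (- 1) ^ d * of_real y ^ d)"
    by (intro C_on_cmult C_on_power assms)
  then have "C_on k S (\<lambda>y. complex_of_real (- y) ^ d)"
    by (simp add: power_mult_distrib[symmetric])
  ultimately show ?thesis by (intro C_on_mult assms)
qed

lemma C_on_fourier_pole:
  assumes "d > 0" "S = {0..} \<or> S = {..0}"
  shows "C_on k S (fourier (pole d))"
proof -
  have S: "no_isolated S" using assms(2) no_isolated_half_line by blast
  from assms(2) show ?thesis
  proof
    assume "S = {0..}"
    then have "C_on k S (fourier (pole d)) \<longleftrightarrow> C_on k S (\<lambda>y. 0)"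
      by (intro C_on_cong) (simp add: fourier_pole[OF assms(1)] half_gamma_def)
    then show ?thesis using C_on_const[OF S] by blast
  next
    assume "S = {..0}"
    then have "C_on k S (fourier (pole d)) \<longleftrightarrow>
        C_on k S (\<lambda>y. 2 * of_real pi / fact d * (of_real (- y) ^ d * of_real (exp y)))"
      \<comment> \<open>At the endpoint 0 both sides vanish, because d is positive.\<close>
      using assms(1) by (intro C_on_cong) (auto simp: fourier_pole half_gamma_def)
    then show ?thesis using C_on_cmult[OF S C_on_power_exp[OF S]] by blast
  qed
qed

text \<open>Subtracting a multiple of \<open>pole d\<close> improves the decay by one order, so that the
  Fourier transform gains a derivative.\<close>

lemma smooth_half_line_fourier_I_space:
  assumes "\<phi> \<in> I_space d" "d > 0" "S = {0..} \<or> S = {..0}"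
  shows "smooth_fun_on S (fourier \<phi>)"
proof -
  have S: "no_isolated S" using assms(3) no_isolated_half_line by blast
  \<comment> \<open>\<open>n\<close> counts the derivatives that decay alone provides and
    \<open>m\<close> those still to be gained; the induction step moves one unit from
    \<open>m\<close> to \<open>n\<close>.\<close>
  have "C_on (n + m) S (fourier \<phi>)" if "\<phi> \<in> I_space (Suc n)" for n m \<phi>
    using that
  proof (induction m arbitrary: n \<phi>)
    case 0
    then show ?case
      using C_on_subset[OF no_isolated_UNIV S _ C_on_fourier_I_space] by simp
  next
    case (Suc m)
    obtain c where c: "(\<lambda>x. \<phi> x + c * pole (Suc n) x) \<in> I_space (Suc (Suc n))"
      using I_space_subtract_pole[OF Suc.prems] by blast
    have "fourier \<phi> = (\<lambda>y. fourier (\<lambda>x. \<phi> x + c * pole (Suc n) x) y + (- c) * fourier (pole (Suc n)) y)"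
      using I_space_integrable[OF Suc.prems] I_space_integrable[OF pole_in_I_space[of "Suc n"]]
      by (simp add: fourier_add fourier_cmult)
    moreover have "C_on (Suc n + m) S (fourier (\<lambda>x. \<phi> x + c * pole (Suc n) x))"
      by (rule Suc.IH[OF c])
    moreover have "C_on (Suc n + m) S (\<lambda>y. (- c) * fourier (pole (Suc n)) y)"
      by (intro C_on_cmult[OF S] C_on_fourier_pole assms(3)) simp
    ultimately show ?case
      using C_on_add[OF S] by (simp only: add_Suc add_Suc_right)
  qed
  from this[of \<phi> "d - 1"] have "C_on (d - 1 + k) S (fourier \<phi>)" for k
    using assms(1,2) by (simp only: Suc_diff_1)
  then show ?thesis
    unfolding smooth_fun_on_def using C_on_lessI[OF S] le_add2 by blast
qed

section \<open>Fourier transforms of functions with a jump at 0\<close>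

text \<open>Decay without any regularity at 0: enough to differentiate the transform arbitrarily
  often, even when \<open>w\<close> jumps there.\<close>

definition moments :: "(real \<Rightarrow> complex) \<Rightarrow> bool" where
  "moments w \<longleftrightarrow> (\<forall>j::nat. integrable lborel (\<lambda>y. of_real y ^ j * w y))"

lemma moments_integrable:
  assumes "moments w"
  shows "integrable lborel w" "integrable lborel (\<lambda>y. of_real y * w y)"
proof -
  have "integrable lborel (\<lambda>y. of_real y ^ j * w y)" for j :: nat
    using assms by (simp add: moments_def)
  from this[of 0] this[of 1] show "integrable lborel w" "integrable lborel (\<lambda>y. of_real y * w y)"
    by simp_all
qed

lemma moments_mult_id: "moments w \<Longrightarrow> moments (\<lambda>y. \<i> * (of_real y * w y))"
  unfolding moments_def
proof
  fix j :: nat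
  assume "\<forall>j. integrable lborel (\<lambda>y. of_real y ^ j * w y)"
  then have "integrable lborel (\<lambda>y. \<i> * (of_real y ^ Suc j * w y))"
    by (intro integrable_mult_right) blast
  then show "integrable lborel (\<lambda>y. of_real y ^ j * (\<i> * (of_real y * w y)))"
    by (simp add: ac_simps)
qed

lemma fourier_moments_deriv:
  "moments w \<Longrightarrow> (fourier w has_vector_derivative fourier (\<lambda>y. \<i> * (of_real y * w y)) x) (at x)"
  by (intro has_vector_derivative_fourier moments_integrable)

lemma C_on_fourier_moments: "moments w \<Longrightarrow> C_on m UNIV (fourier w)"
proof (induction m arbitrary: w)
  case 0
  then show ?case by (simp add: C_on_0 continuous_on_fourier moments_integrable)
next
  case (Suc m)
  then show ?case
    by (intro C_on_SucI[OF no_isolated_UNIV fourier_moments_deriv]) (auto intro: moments_mult_id)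
qed

lemma has_vector_derivative_mult_id_at_0:
  assumes "isCont u 0"
  shows "((\<lambda>x. of_real x * u x) has_vector_derivative (u 0 :: complex)) (at 0)"
proof -
  have "((\<lambda>x. norm (u x - u 0)) \<longlongrightarrow> 0) (at 0)"
    using assms unfolding isCont_def by (intro tendsto_norm_zero LIM_zero)
  moreover have "\<forall>\<^sub>F x in at 0. norm (u x - u 0) = norm (of_real x * u x - of_real 0 * u 0 - (x - 0) *\<^sub>R u 0) / norm (x - 0)"
    unfolding eventually_at_filter
  proof (rule always_eventually, intro allI impI)
    fix x :: real assume "x \<noteq> 0"
    have "of_real x * u x - of_real 0 * u 0 - (x - 0) *\<^sub>R u 0 = of_real x * (u x - u 0)"
      by (simp add: scaleR_conv_of_real algebra_simps)
    then show "norm (u x - u 0) = norm (of_real x * u x - of_real 0 * u 0 - (x - 0) *\<^sub>R u 0) / norm (x - 0)"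
      using \<open>x \<noteq> 0\<close> by (simp only: norm_mult norm_of_real) simp
  qed
  ultimately have "((\<lambda>x. norm (of_real x * u x - of_real 0 * u 0 - (x - 0) *\<^sub>R u 0) / norm (x - 0)) \<longlongrightarrow> 0) (at 0)"
    by (rule Lim_transform_eventually)
  then show ?thesis
    unfolding has_vector_derivative_def has_derivative_iff_norm by (simp add: bounded_linear_scaleR_left)
qed

text \<open>Each derivative of \<open>t \<mapsto> fourier w (- 1 / t)\<close> costs a factor \<open>1 / t\<^sup>2\<close>.\<close>

lemma C_on_power_fourier_at_infinity:
  assumes "moments w" "2 * m + 1 \<le> n"
  shows "C_on m UNIV (\<lambda>x. of_real x ^ n * fourier w (- 1 / x))"
  using assms
proof (induction m arbitrary: n w)
  case 0
  define B where "B = (LINT y|lborel. norm (w y))"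
  have "isCont (\<lambda>x. of_real x ^ n * fourier w (- 1 / x)) x" for x
  proof (cases "x = 0")
    \<comment> \<open>Division by zero makes the value at 0 equal to
      \<open>0 ^ n * fourier w 0\<close>, which is 0 as \<open>n\<close> is at least 1; it is also
      the limit, because the transform is bounded.\<close>
    case True
    have "((\<lambda>x::real. of_real x ^ n * fourier w (- 1 / x)) \<longlongrightarrow> 0) (at 0)"
    proof (rule Lim_null_comparison)
      show "\<forall>\<^sub>F x in at 0. norm (of_real x ^ n * fourier w (- 1 / x)) \<le> \<bar>x\<bar> ^ n * B"
        unfolding B_def
        by (intro always_eventually allI)
           (simp add: norm_mult norm_power mult_left_mono norm_fourier_le moments_integrable[OF 0(1)])
      have "((\<lambda>x::real. \<bar>x\<bar> ^ n * B) \<longlongrightarrow> \<bar>0\<bar> ^ n * B) (at 0)"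
        by (intro tendsto_intros)
      then show "((\<lambda>x::real. \<bar>x\<bar> ^ n * B) \<longlongrightarrow> 0) (at 0)"
        using 0(2) by (simp add: power_0_left)
    qed
    then show ?thesis using 0(2) True by (simp add: isCont_def power_0_left)
  next
    case False
    have "isCont (\<lambda>x. fourier w (- 1 / x)) x"
      by (rule has_vector_derivative_continuous)
         (rule has_vector_derivative_minus_inverse[OF fourier_moments_deriv[OF 0(1)] False])
    then show ?thesis by (intro continuous_intros)
  qed
  then show ?case by (simp add: C_on_0 continuous_on_eq_continuous_at)
next
  case (Suc m)
  define F where "F = fourier w"
  define F' where "F' = fourier (\<lambda>y. \<i> * (of_real y * w y))"
  obtain k where n: "n = Suc (Suc k)" and k: "2 * m + 1 \<le> k"
    using Suc.prems(2) by (cases n; cases "n - 1") auto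
  note w' = moments_mult_id[OF Suc.prems(1)]
  \<comment> \<open>The product rule leaves the exponents \<open>n - 1\<close> and, after the loss
    of x^2, \<open>n - 2 = k\<close>; both are still at least \<open>2 * m + 1\<close>.\<close>
  have "C_on m UNIV (\<lambda>x. of_nat n * (of_real x ^ Suc k * F (- 1 / x)) + of_real x ^ k * F' (- 1 / x))"
    unfolding F_def F'_def
    using k by (intro C_on_add C_on_cmult no_isolated_UNIV Suc.IH[OF Suc.prems(1)] Suc.IH[OF w']) auto
  moreover have "((\<lambda>x. of_real x ^ n * F (- 1 / x)) has_vector_derivative
      of_nat n * (of_real x ^ Suc k * F (- 1 / x)) + of_real x ^ k * F' (- 1 / x)) (at x)" for x
  proof (cases "x = 0")
    case True
    have "C_on 0 UNIV (\<lambda>x. of_real x ^ Suc k * F (- 1 / x))"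
      unfolding F_def
      by (rule C_on_lessI[OF no_isolated_UNIV Suc.IH[OF Suc.prems(1)]]) (use k in auto)
    then have "isCont (\<lambda>x. of_real x ^ Suc k * F (- 1 / x)) 0"
      by (simp add: C_on_0 continuous_on_eq_continuous_at)
    from has_vector_derivative_mult_id_at_0[OF this] show ?thesis
      using True k by (simp add: n mult.assoc power_0_left)
  next
    case False
    have "((\<lambda>x. complex_of_real x ^ n) has_vector_derivative of_nat n * of_real x ^ Suc k) (at x)"
      unfolding n by (rule has_vector_derivative_of_real_power)
    moreover have "((\<lambda>x. F (- 1 / x)) has_vector_derivative (1 / x\<^sup>2) *\<^sub>R F' (- 1 / x)) (at x)"
      unfolding F_def F'_def
      by (rule has_vector_derivative_minus_inverse[OF fourier_moments_deriv[OF Suc.prems(1)] False])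
    ultimately have "((\<lambda>x. of_real x ^ n * F (- 1 / x)) has_vector_derivative
       of_real x ^ n * ((1 / x\<^sup>2) *\<^sub>R F' (- 1 / x)) + of_nat n * of_real x ^ Suc k * F (- 1 / x)) (at x)"
      by (rule has_vector_derivative_mult)
    moreover have "of_real x ^ n * ((1 / x\<^sup>2) *\<^sub>R F' (- 1 / x)) = of_real x ^ k * F' (- 1 / x)"
      using False by (simp add: n scaleR_conv_of_real power2_eq_square)
    ultimately show ?thesis by (simp only: mult.assoc add.commute)
  qed
  ultimately show ?case
    unfolding F_def by (intro C_on_SucI[OF no_isolated_UNIV]) auto
qed

section \<open>One-sided limits of derivatives and the expansion at infinity\<close>

lemma nth_deriv_on_half_line_lims:
  assumes S: "S = {0..} \<and> V = {0<..} \<or> S = {..0} \<and> V = {..<0}"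
    and g: "smooth_fun_on S g" "\<And>y. y \<in> V \<Longrightarrow> g y = h y"
  shows "(nth_deriv_on n punctured_line h \<longlongrightarrow> nth_deriv_on n S g 0) (at 0 within V)"
proof -
  have "continuous_on S (nth_deriv_on n S g)"
    using g(1) by (auto simp: smooth_fun_on_def C_on_def)
  moreover have "0 \<in> S" "V \<subseteq> S" using S by auto
  ultimately have "(nth_deriv_on n S g \<longlongrightarrow> nth_deriv_on n S g 0) (at 0 within V)"
    unfolding continuous_on_def using tendsto_within_subset by blast
  moreover have "nth_deriv_on n S g y = nth_deriv_on n punctured_line h y" if "y \<in> V" for y
    by (rule nth_deriv_on_local[where V = V]) (use S g(2) that in auto)
  then have "\<forall>\<^sub>F y in at 0 within V. nth_deriv_on n S g y = nth_deriv_on n punctured_line h y"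
    by (simp add: eventually_at_filter)
  ultimately show ?thesis by (rule Lim_transform_eventually)
qed

lemma rapid_nth_deriv:
  assumes "\<And>n. rapid n h"
  shows "y \<noteq> 0 \<Longrightarrow> (nth_deriv_on n punctured_line h has_vector_derivative nth_deriv_on (Suc n) punctured_line h y) (at y)"
    and "continuous_on punctured_line (nth_deriv_on n punctured_line h)"
    and "rapidly_decreasing (nth_deriv_on n punctured_line h)"
proof -
  assume "y \<noteq> 0"
  then have "nth_deriv_on n punctured_line h differentiable (at y within punctured_line)"
    using assms[of "Suc n"] by (simp add: rapid_def C_on_def)
  then show "(nth_deriv_on n punctured_line h has_vector_derivative nth_deriv_on (Suc n) punctured_line h y) (at y)"
    using at_within_punctured_line[OF \<open>y \<noteq> 0\<close>] by (simp add: vector_derivative_works)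
next
  show "continuous_on punctured_line (nth_deriv_on n punctured_line h)"
    using assms[of n] by (simp add: rapid_def C_on_def)
  show "rapidly_decreasing (nth_deriv_on n punctured_line h)"
    using assms[of n] by (simp add: rapid_def)
qed

lemma rapidly_decreasing_moments:
  assumes "continuous_on punctured_line w" "rapidly_decreasing w"
    "(w \<longlongrightarrow> lp) (at_right 0)" "(w \<longlongrightarrow> lm) (at_left 0)"
  shows "moments w"
  unfolding moments_def
proof
  fix j :: nat
  have cont: "continuous_on punctured_line (\<lambda>y. of_real y ^ j * w y)"
    by (intro continuous_intros assms(1))
  have "((\<lambda>y. of_real y ^ j * w y) \<longlongrightarrow> of_real 0 ^ j * lp) (at_right 0)"
    "((\<lambda>y. of_real y ^ j * w y) \<longlongrightarrow> of_real 0 ^ j * lm) (at_left 0)"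
    by (intro tendsto_intros assms)+
  from rapidly_decreasing_decay[OF cont rapidly_decreasing_mult_power[OF assms(2)] this]
  show "integrable lborel (\<lambda>y. of_real y ^ j * w y)"
    using integrable_inverse_square_decay[OF borel_measurable_continuous_on_punctured_line[OF cont]] by blast
qed

lemma fourier_in_I_space:
  assumes h: "\<And>n. rapid n h"
    and right: "smooth_right_at_0 h" and left: "smooth_left_at_0 h"
    and cont: "has_cont_derivs_at_0 (d - 1) h" and "d > 0"
  shows "fourier h \<in> I_space d"
proof -
  define D where "D n = nth_deriv_on n punctured_line h" for n
  obtain gp where gp: "smooth_fun_on {0..} gp" "\<And>y. y > 0 \<Longrightarrow> gp y = h y"
    using right unfolding smooth_right_at_0_def by blast
  obtain gm where gm: "smooth_fun_on {..0} gm" "\<And>y. y < 0 \<Longrightarrow> gm y = h y"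
    using left unfolding smooth_left_at_0_def by blast
  define lp where "lp n = nth_deriv_on n {0..} gp 0" for n
  define lm where "lm n = nth_deriv_on n {..0} gm 0" for n
  have lp: "(D n \<longlongrightarrow> lp n) (at_right 0)" for n
    unfolding D_def lp_def by (rule nth_deriv_on_half_line_lims) (use gp in auto)
  have lm: "(D n \<longlongrightarrow> lm n) (at_left 0)" for n
    unfolding D_def lm_def by (rule nth_deriv_on_half_line_lims) (use gm in auto)
  \<comment> \<open>Below order d, both one-sided limits equal the derivative at 0 of the extension
    whose first d - 1 derivatives are continuous.\<close>
  have jump: "lp n = lm n" if "n < d" for n
  proof -
    obtain g U where g: "\<And>y. y \<noteq> 0 \<Longrightarrow> g y = h y" and U: "open U" "0 \<in> U" and C: "C_on (d - 1) U g"
      using cont unfolding has_cont_derivs_at_0_def by blast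
    have "C_on n U g"
      using C_on_lessI[OF no_isolated_open[OF U(1)] C] that by simp
    then have "isCont (nth_deriv_on n U g) 0"
      using U by (simp add: C_on_def continuous_on_eq_continuous_at)
    then have lim: "(nth_deriv_on n U g \<longlongrightarrow> nth_deriv_on n U g 0) (at 0)"
      by (simp add: isCont_def)
    have "\<forall>\<^sub>F y in at 0. y \<in> U - {0}"
      using U by (rule eventually_at_in_open)
    then have "\<forall>\<^sub>F y in at 0. nth_deriv_on n U g y = D n y"
    proof eventually_elim
      case (elim y)
      then show ?case
        unfolding D_def by (intro nth_deriv_on_local[where V = "U - {0}"]) (use U g in auto)
    qed
    with lim have "(D n \<longlongrightarrow> nth_deriv_on n U g 0) (at 0)"
      by (rule Lim_transform_eventually)
    then have "(D n \<longlongrightarrow> nth_deriv_on n U g 0) (at_right 0)" "(D n \<longlongrightarrow> nth_deriv_on n U g 0) (at_left 0)"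
      by (auto intro: tendsto_within_subset)
    then have "nth_deriv_on n U g 0 = lp n" "nth_deriv_on n U g 0 = lm n"
      using lp lm by (auto intro: tendsto_unique[rotated])
    then show ?thesis by simp
  qed
  have D_deriv: "(D n has_vector_derivative D (Suc n) y) (at y)" if "y \<noteq> 0" for n y
    unfolding D_def using rapid_nth_deriv(1)[OF h that] .
  have D_cont: "continuous_on punctured_line (D n)" and D_rd: "rapidly_decreasing (D n)" for n
    unfolding D_def using rapid_nth_deriv(2,3)[OF h] .
  have D_moments: "moments (D n)" for n
    by (rule rapidly_decreasing_moments[OF D_cont D_rd lp lm])
  have D_0: "(D n \<longlongrightarrow> 0) at_infinity" for n
    using rapidly_decreasing_decay[OF D_cont D_rd lp lm] tendsto_inverse_square_decay by blast
  have parts: "\<i> * of_real x * fourier (D n) x + fourier (D (Suc n)) x = lm n - lp n" for n x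
    by (rule fourier_by_parts[OF moments_integrable(1)[OF D_moments] moments_integrable(1)[OF D_moments]
          D_deriv D_cont lp lm D_0])
  \<comment> \<open>The transform of the \<open>n\<close>-th derivative in the chart at infinity.
    The value 0 at 0 is set by hand; division by zero would give \<open>fourier (D n) 0\<close>
    instead of the limit.\<close>
  define Q where "Q n x = (if x = 0 then 0 else fourier (D n) (- 1 / x))" for n x
  have Q: "Q n x = \<i> * of_real x * ((lm n - lp n) - Q (Suc n) x)" for n x
  proof (cases "x = 0")
    case False
    have "lm n - lp n - fourier (D (Suc n)) (- 1 / x) = \<i> * of_real (- 1 / x) * fourier (D n) (- 1 / x)"
      unfolding parts[of "- 1 / x" n, symmetric] by (rule add_diff_cancel_right')
    then show ?thesis using False by (simp add: Q_def mult.assoc[symmetric])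
  qed (simp add: Q_def)
  \<comment> \<open>\<open>i\<close> is the number of powers of x missing from
    \<open>2 * m + 1\<close>. Each use of \<open>Q\<close> splits off a monomial and raises both the
    exponent and the order of the derivative by one.\<close>
  have Q_C: "C_on m UNIV (\<lambda>x. of_real x ^ n * Q k x)" if "n + i = 2 * m + 1" for n i m k
    using that
  proof (induction i arbitrary: n k)
    case 0
    then have "C_on m UNIV (\<lambda>x. of_real x ^ n * Q k x) \<longleftrightarrow> C_on m UNIV (\<lambda>x. of_real x ^ n * fourier (D k) (- 1 / x))"
      by (intro C_on_cong) (auto simp: Q_def)
    moreover have "2 * m + 1 \<le> n" using 0 by simp
    ultimately show ?case using C_on_power_fourier_at_infinity[OF D_moments] by blast
  next
    case (Suc i)
    have "C_on m UNIV (\<lambda>x. \<i> * (lm k - lp k) * of_real x ^ Suc n + (- \<i>) * (of_real x ^ Suc n * Q (Suc k) x))"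
      by (intro C_on_add C_on_cmult C_on_power no_isolated_UNIV Suc.IH) (use Suc.prems in simp)
    moreover have "of_real x ^ n * Q k x = \<i> * (lm k - lp k) * of_real x ^ Suc n + (- \<i>) * (of_real x ^ Suc n * Q (Suc k) x)" for x
      by (subst Q) (simp add: algebra_simps)
    ultimately show ?case by simp
  qed
  have Q_smooth: "smooth_fun_on UNIV (Q k)" for k
    unfolding smooth_fun_on_def using Q_C[of 0 "2 * m + 1" m k for m] by simp
  \<comment> \<open>Each of the first d steps of the recursion has zero jump and only contributes a
    factor - \<i> x. A further step, whose jump need not vanish, supplies the last power in x^(d +
    1).\<close>
  have Q_0: "Q 0 x = (- \<i>) ^ n * of_real x ^ n * Q n x" if "n \<le> d" for n x
    using that
  proof (induction n)
    case (Suc n)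
    then show ?case using Q[of n x] jump[of n] by simp
  qed simp
  let ?\<psi> = "\<lambda>x. (- \<i>) ^ d * \<i> * ((lm d - lp d) + (- 1) * Q (Suc d) x)"
  have "fourier h (- 1 / x) = of_real x ^ Suc d * ?\<psi> x" if "x \<noteq> 0" for x
  proof -
    have "fourier h (- 1 / x) = Q 0 x" using that by (simp add: Q_def D_def)
    also have "\<dots> = (- \<i>) ^ d * of_real x ^ d * Q d x" by (rule Q_0) simp
    finally show ?thesis by (subst (asm) Q) simp
  qed
  moreover have "smooth_fun_on UNIV ?\<psi>"
    unfolding smooth_fun_on_def using Q_smooth[unfolded smooth_fun_on_def]
    by (intro allI C_on_cmult C_on_add C_on_const no_isolated_UNIV) blast
  moreover have "smooth_fun_on UNIV (fourier h)"
    using D_moments[of 0] by (simp add: smooth_fun_on_def C_on_fourier_moments D_def)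
  ultimately show ?thesis unfolding I_space_iff by blast
qed

section \<open>Weights and normalization of \<open>M_op\<close>, and the two inclusions\<close>

lemma I_space_cmult:
  assumes "\<phi> \<in> I_space d"
  shows "(\<lambda>x. c * \<phi> x) \<in> I_space d"
proof -
  obtain \<psi> where \<phi>: "smooth_fun_on UNIV \<phi>" and \<psi>: "smooth_fun_on UNIV \<psi>"
    and eq: "\<And>x. x \<noteq> 0 \<Longrightarrow> \<phi> (- 1 / x) = of_real x ^ Suc d * \<psi> x"
    using assms unfolding I_space_iff by blast
  have "c * \<phi> (- 1 / x) = of_real x ^ Suc d * (c * \<psi> x)" if "x \<noteq> 0" for x
    unfolding eq[OF that] by simp
  then show ?thesis
    unfolding I_space_iff using smooth_cmult[OF no_isolated_UNIV] \<phi> \<psi> by blast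
qed

lemma M_op_eq:
  assumes "y \<noteq> 0"
  shows "M_op d \<phi> y = of_real (\<bar>y\<bar> powr ((- real d + 1) / 2)) * (of_real ((2 * pi) powr (- 1 / 2)) * fourier \<phi> (- y))"
proof -
  have "(LINT x|lborel. \<phi> x * exp (- \<i> * of_real x * of_real y)) = fourier \<phi> (- y)"
    unfolding fourier_def by (intro Bochner_Integration.integral_cong) (simp_all add: mult.commute mult.left_commute)
  then show ?thesis using assms by (simp add: M_op_def)
qed

lemma fourier_reflect: "fourier (\<lambda>x. \<phi> (- x)) y = fourier \<phi> (- y)"
  unfolding fourier_def
  by (subst lborel_integral_real_affine[where c = "- 1" and t = 0]) simp_all

lemma abs_powr_cancel:
  assumes "y \<noteq> 0"
  shows "\<bar>y\<bar> powr ((real d - 1) / 2) * \<bar>y\<bar> powr ((- real d + 1) / 2) = 1"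
proof -
  have "(real d - 1) / 2 + (- real d + 1) / 2 = 0" by (simp add: field_simps)
  then show ?thesis using assms by (simp flip: powr_add)
qed

theorem theorem4p14:
  fixes d :: nat
  assumes "d > 0"
  shows "S_tilde d =
    {f \<in> (UNIV - {0}) \<rightarrow>\<^sub>E UNIV.
       smooth_fun_on (UNIV - {0}) f \<and>
       (\<forall>n. rapidly_decreasing (nth_deriv_on n (UNIV - {0}) f)) \<and>
       smooth_right_at_0 (\<lambda>y. of_real (\<bar>y\<bar> powr ((real d - 1) / 2)) * f y) \<and>
       smooth_left_at_0 (\<lambda>y. of_real (\<bar>y\<bar> powr ((real d - 1) / 2)) * f y) \<and>
       has_cont_derivs_at_0 (d - 1) (\<lambda>y. of_real (\<bar>y\<bar> powr ((real d - 1) / 2)) * f y)}"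
    (is "_ = ?R")
proof (intro equalityI subsetI)
  fix f assume "f \<in> S_tilde d"
  then obtain \<phi> where \<phi>: "\<phi> \<in> I_space d" and f: "f = M_op d \<phi>"
    unfolding S_tilde_def by blast
  define c where "c = complex_of_real ((2 * pi) powr (- 1 / 2))"
  \<comment> \<open>\<open>M_op d \<phi>\<close> stripped of its weight. Off 0 it is the weighted
    function of the theorem, and since it is defined on the whole line it serves as the extension in
    all three conditions at 0.\<close>
  define G where "G = (\<lambda>y. c * fourier (\<lambda>x. \<phi> (- x)) y)"
  note \<phi>' = I_space_reflect[OF \<phi>]
  have fG: "f y = of_real (\<bar>y\<bar> powr ((- real d + 1) / 2)) * G y" if "y \<noteq> 0" for y
    unfolding f M_op_eq[OF that] G_def c_def fourier_reflect ..
  have GF: "of_real (\<bar>y\<bar> powr ((real d - 1) / 2)) * f y = G y" if "y \<noteq> 0" for y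
    unfolding fG[OF that] mult.assoc[symmetric] of_real_mult[symmetric] abs_powr_cancel[OF that] by simp
  have "rapid n (\<lambda>y. of_real (\<bar>y\<bar> powr ((- real d + 1) / 2)) * G y)" for n
    unfolding G_def by (intro rapid_powr rapid_cmult rapid_fourier_I_space[OF \<phi>' assms])
  then have "rapid n f" for n
    using fG by (rule rapid_cong)
  then have "smooth_fun_on punctured_line f \<and> (\<forall>n. rapidly_decreasing (nth_deriv_on n punctured_line f))"
    by (simp flip: rapid_smooth)
  moreover have "smooth_fun_on {0..} G" "smooth_fun_on {..0} G"
    unfolding G_def
    by (intro smooth_cmult no_isolated_half_line smooth_half_line_fourier_I_space[OF \<phi>' assms]; simp)+
  then have "smooth_right_at_0 (\<lambda>y. of_real (\<bar>y\<bar> powr ((real d - 1) / 2)) * f y)"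
    "smooth_left_at_0 (\<lambda>y. of_real (\<bar>y\<bar> powr ((real d - 1) / 2)) * f y)"
    unfolding smooth_right_at_0_def smooth_left_at_0_def using GF by (metis less_irrefl)+
  moreover have "C_on (d - 1) UNIV G"
    unfolding G_def using \<phi>' assms
    by (intro C_on_cmult no_isolated_UNIV C_on_fourier_I_space) simp
  then have "has_cont_derivs_at_0 (d - 1) (\<lambda>y. of_real (\<bar>y\<bar> powr ((real d - 1) / 2)) * f y)"
    unfolding has_cont_derivs_at_0_def using GF
    by (intro exI[of _ G] exI[of _ UNIV]) auto
  moreover have "f \<in> punctured_line \<rightarrow>\<^sub>E UNIV"
    unfolding f M_op_def by auto
  ultimately show "f \<in> ?R" by blast
next
  fix f assume f: "f \<in> ?R"
  define h where "h = (\<lambda>y. of_real (\<bar>y\<bar> powr ((real d - 1) / 2)) * f y)"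
  have "rapid n f" for n
    using f rapid_smooth[of f] by blast
  then have h: "rapid n h" for n
    unfolding h_def by (rule rapid_powr)
  have lims: "smooth_right_at_0 h" "smooth_left_at_0 h" "has_cont_derivs_at_0 (d - 1) h"
    using f unfolding h_def by blast+
  note Fh = fourier_in_I_space[OF h lims assms]
  obtain gp where gp: "smooth_fun_on {0..} gp" "\<And>y. y > 0 \<Longrightarrow> gp y = h y"
    using lims(1) unfolding smooth_right_at_0_def by blast
  obtain gm where gm: "smooth_fun_on {..0} gm" "\<And>y. y < 0 \<Longrightarrow> gm y = h y"
    using lims(2) unfolding smooth_left_at_0_def by blast
  have "(h \<longlongrightarrow> gp 0) (at_right 0)" "(h \<longlongrightarrow> gm 0) (at_left 0)"
    using nth_deriv_on_half_line_lims[of "{0..}" "{0<..}" gp h 0] gp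
      nth_deriv_on_half_line_lims[of "{..0}" "{..<0}" gm h 0] gm by auto
  moreover have cont: "continuous_on punctured_line h" "rapidly_decreasing h"
    using h[of 0] by (simp_all add: rapid_0)
  ultimately obtain C where C: "\<And>y. norm (h y) \<le> C / (1 + y\<^sup>2)"
    using rapidly_decreasing_decay by blast
  have int: "integrable lborel h"
    using borel_measurable_continuous_on_punctured_line[OF cont(1)] C
    by (rule integrable_inverse_square_decay)
  have bound: "norm (h y) \<le> \<bar>C\<bar>" for y
    using C by (rule inverse_square_decay_bounded)
  define c where "c = complex_of_real ((2 * pi) powr (- 1 / 2))"
  have "c * c = of_real ((2 * pi) powr (- 1 / 2) * (2 * pi) powr (- 1 / 2))"
    by (simp add: c_def)
  also have "(2 * pi) powr (- 1 / 2) * (2 * pi) powr (- 1 / 2) = (2 * pi) powr (- 1)"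
    unfolding powr_add[symmetric] by simp
  also have "\<dots> = 1 / (2 * pi)" by (simp add: powr_minus_divide)
  \<comment> \<open>Two normalizing factors cancel the 2 pi of the inversion formula.\<close>
  finally have cc: "c * (c * (2 * of_real pi * z)) = z" for z
    by (simp add: mult.assoc[symmetric])
  \<comment> \<open>The preimage of \<open>f\<close>: \<open>M_op\<close> evaluates the second
    transform at \<open>- y\<close>, exactly the form in which inversion returns
    \<open>h y\<close>.\<close>
  define \<phi> where "\<phi> = (\<lambda>x. c * fourier h x)"
  have "M_op d \<phi> y = f y" for y
  proof (cases "y = 0")
    case True
    \<comment> \<open>Both functions are extensional on the punctured line, hence
      \<open>undefined\<close> at 0.\<close>
    then show ?thesis using f by (auto simp: M_op_def PiE_def extensional_def)
  next
    case False
    \<comment> \<open>Inversion is applied off 0 only: the \<open>powr\<close> convention forces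
      \<open>h 0 = 0\<close>, which need not be the limit of \<open>h\<close>.\<close>
    have "isCont h y"
      using cont(1) False by (simp add: continuous_on_eq_continuous_at open_delete)
    then have "fourier \<phi> (- y) = c * (2 * of_real pi * h y)"
      unfolding \<phi>_def fourier_cmult
      using fourier_inversion[OF int bound I_space_integrable[OF Fh assms]] by simp
    then have "M_op d \<phi> y = of_real (\<bar>y\<bar> powr ((- real d + 1) / 2)) * h y"
      unfolding M_op_eq[OF False] c_def[symmetric] by (simp only: cc)
    also have "\<dots> = of_real (\<bar>y\<bar> powr ((real d - 1) / 2) * \<bar>y\<bar> powr ((- real d + 1) / 2)) * f y"
      by (simp add: h_def)
    finally show ?thesis by (simp only: abs_powr_cancel[OF False] of_real_1 mult_1)
  qed
  then have "f = M_op d \<phi>" by auto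
  then show "f \<in> S_tilde d"
    unfolding S_tilde_def \<phi>_def using I_space_cmult[OF Fh] by blast
qed

end
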